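(* Let $F=x_0^ax_1^bx_2^c\in\mathbb{C}[x_0,x_1,x_2]$ with $0<a\leq b\leq c$ and let $r=(a+1)(b+1)=\underline{\mathbf{rk}}(F)$. If $c\geq a+b$, then $\mathrm{VPS}(F,r)=\{\mathrm{Proj}(S/J)\}$, where $J=(y_0^{a+1},y_1^{b+1})$, and $\underline{\mathrm{VSP}}(F,r)$ is of fiber type.
   Context: $X=\mathbb{P}^2$; $S=\mathbb{C}[y_0,y_1,y_2]$ and $T=\mathbb{C}[x_0,x_1,x_2]$ are standard graded, $S$ acting on $T$ by differentiation ($y_i\circ x_j=\delta_{ij}$); $\mathrm{Ann}(F)=\{\psi\in S:\psi\circ F=0\}$. $\underline{\mathbf{rk}}(F)$ is the border rank of $F$ with respect to the Veronese embedding $\nu_{\deg F}(\mathbb{P}^2)$ (least $r$ with $[F]$ in the $r$-th secant variety); for monomials as in the claim it is known that $\underline{\mathbf{rk}}(F)=(a+1)(b+1)$. $h_{r,\mathbb{P}^2}(k)=\min\{r,\dim_{\mathbb C}S_k\}$; $\mathrm{Slip}_{r,\mathbb{P}^2}$ is the irreducible component of the multigraded Hilbert scheme $\mathrm{Hilb}_S^{h_{r,\mathbb{P}^2}}$ (of homogeneous ideals whose quotient has Hilbert function $h_{r,\mathbb{P}^2}$) that is the closure of the locus of saturated ideals of $r$ distinct points with Hilbert function $h_{r,\mathbb{P}^2}$. $\underline{\mathrm{VSP}}(F,r)=\{J\in\mathrm{Slip}_{r,\mathbb{P}^2}:J\subset\mathrm{Ann}(F)\}$. $\mathrm{VPS}(F,r)=\{Z\in\mathrm{Hilb}^r(\mathbb{P}^2):I_Z\subset\mathrm{Ann}(F)\}$,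 $I_Z$ being the saturated ideal of $Z$. $\phi_{r,\mathbb{P}^2}\colon\mathrm{Slip}_{r,\mathbb{P}^2}\to\mathrm{Hilb}^r(\mathbb{P}^2)$ sends $J$ to $\mathrm{Proj}(S/J)$. $\underline{\mathrm{VSP}}(F,r)$ is of fiber type if $\underline{\mathrm{VSP}}(F,r)=\phi_{r,\mathbb{P}^2}^{-1}(\mathrm{VPS}(F,r))$. *)

theory Defs
  imports "HOL-Analysis.Analysis" "HOL-Library.Poly_Mapping"
begin

section \<open>The polynomial rings\<close>

text \<open>Elements of \<open>3 \<Rightarrow>\<^sub>0 nat\<close> are exponent vectors in three variables indexed by
  \<open>0, 1, 2 :: 3\<close>, and \<open>(3 \<Rightarrow>\<^sub>0 nat) \<Rightarrow>\<^sub>0 complex\<close> with its convolution product is the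
  polynomial ring in three variables. The same type serves for \<open>S = \<complex>[y\<^sub>0,y\<^sub>1,y\<^sub>2]\<close> and for
  \<open>T = \<complex>[x\<^sub>0,x\<^sub>1,x\<^sub>2]\<close>; the role is determined by the argument position in \<open>act\<close> below.\<close>

type_synonym mono3 = "3 \<Rightarrow>\<^sub>0 nat"
type_synonym poly3 = "mono3 \<Rightarrow>\<^sub>0 complex"

definition X :: "3 \<Rightarrow> poly3" where
  "X i = Poly_Mapping.single (Poly_Mapping.single i 1) 1"

definition smul :: "complex \<Rightarrow> poly3 \<Rightarrow> poly3" where
  "smul c f = Poly_Mapping.single 0 c * f"

global_interpretation cvs: vector_space smul
  by unfold_locales
    (simp_all add: smul_def single_add distrib_left distrib_right mult_single
      flip: mult.assoc)

text \<open>Submodules of \<open>S\<close> over itself: \<open>idl.subspace I\<close> says that \<open>I\<close> is an ideal, and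
  \<open>idl.span B\<close> is the ideal generated by \<open>B\<close>.\<close>

global_interpretation idl: module "(*) :: poly3 \<Rightarrow> poly3 \<Rightarrow> poly3"
  by unfold_locales (simp_all add: algebra_simps)

text \<open>Evaluation of a polynomial in variables indexed by an arbitrary type.\<close>

definition insertion :: "('i \<Rightarrow> complex) \<Rightarrow> (('i \<Rightarrow>\<^sub>0 nat) \<Rightarrow>\<^sub>0 complex) \<Rightarrow> complex" where
  "insertion v p = (\<Sum>m\<in>Poly_Mapping.keys p. Poly_Mapping.lookup p m *
     (\<Prod>i\<in>Poly_Mapping.keys m. v i ^ Poly_Mapping.lookup m i))"

definition mdeg :: "mono3 \<Rightarrow> nat" where
  "mdeg m = (\<Sum>i\<in>UNIV. Poly_Mapping.lookup m i)"

definition forms :: "nat \<Rightarrow> poly3 set" where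
  "forms k = {f. \<forall>m\<in>Poly_Mapping.keys f. mdeg m = k}"

definition hom_part :: "nat \<Rightarrow> poly3 \<Rightarrow> poly3" where
  "hom_part k f = (\<Sum>m\<in>{m\<in>Poly_Mapping.keys f. mdeg m = k}.
     Poly_Mapping.single m (Poly_Mapping.lookup f m))"

definition homogeneous_ideal :: "poly3 set \<Rightarrow> bool" where
  "homogeneous_ideal J \<longleftrightarrow> idl.subspace J \<and> (\<forall>f\<in>J. \<forall>k. hom_part k f \<in> J)"

definition total_degree :: "poly3 \<Rightarrow> nat" where
  "total_degree f = Max (insert 0 (mdeg ` Poly_Mapping.keys f))"

section \<open>Apolarity\<close>

text \<open>If the exponent of variable \<open>i\<close> in \<open>m\<close> is zero, the coefficient below vanishes, so the
  truncated subtraction of exponents is harmless.\<close>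

definition partial_deriv :: "3 \<Rightarrow> poly3 \<Rightarrow> poly3" where
  "partial_deriv i F = (\<Sum>m\<in>Poly_Mapping.keys F.
     Poly_Mapping.single (m - Poly_Mapping.single i 1)
       (of_nat (Poly_Mapping.lookup m i) * Poly_Mapping.lookup F m))"

definition act :: "poly3 \<Rightarrow> poly3 \<Rightarrow> poly3" where
  "act \<psi> F = (\<Sum>\<alpha>\<in>Poly_Mapping.keys \<psi>. smul (Poly_Mapping.lookup \<psi> \<alpha>)
     ((partial_deriv 0 ^^ Poly_Mapping.lookup \<alpha> 0)
       ((partial_deriv 1 ^^ Poly_Mapping.lookup \<alpha> 1)
         ((partial_deriv 2 ^^ Poly_Mapping.lookup \<alpha> 2) F))))"

lemma act_X_X: "act (X i) (X j) = (if i = j then 1 else 0)"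
proof -
  have pd: "partial_deriv k (X j) = (if k = j then 1 else 0)" for k
    by (auto simp: partial_deriv_def X_def lookup_single when_def)
  have "\<forall>k::3. act (X k) (X j) = (if k = j then 1 else 0)"
    unfolding forall_3 by (auto simp: act_def X_def[of 1] X_def[of 2] X_def[of 3] lookup_single pd)
  then show ?thesis by blast
qed

definition Ann :: "poly3 \<Rightarrow> poly3 set" where
  "Ann F = {\<psi>. act \<psi> F = 0}"

section \<open>Border rank\<close>

text \<open>Projective varieties in \<open>\<P>(T\<^sub>d)\<close> are replaced by their affine cones in \<open>T\<^sub>d\<close>. The topology
  is the Zariski topology, generated by the complements of hypersurfaces; the coordinates on
  \<open>T\<^sub>d\<close> are the coefficients.\<close>

definition zariski_forms :: "nat \<Rightarrow> poly3 topology" where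
  "zariski_forms d = topology_generated_by
     {{G \<in> forms d. insertion (Poly_Mapping.lookup G) p \<noteq> 0} | p. True}"

definition veronese :: "nat \<Rightarrow> poly3 set" where
  "veronese d = {L ^ d | L. L \<in> forms 1 \<and> L \<noteq> 0}"

definition secant :: "nat \<Rightarrow> nat \<Rightarrow> poly3 set" where
  "secant d r = zariski_forms d closure_of
     (\<Union>{cvs.span A | A. A \<subseteq> veronese d \<and> finite A \<and> card A \<le> r})"

definition border_rank :: "poly3 \<Rightarrow> nat" where
  "border_rank F = (LEAST r. F \<in> secant (total_degree F) r)"

section \<open>Hilbert functions and the multigraded Hilbert scheme\<close>

text \<open>\<open>hilb_fun J k = dim (S/J)\<^sub>k\<close>: since \<open>J \<inter> S\<^sub>k\<close> is a subspace of the finite-dimensional space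
  \<open>S\<^sub>k\<close>, the dimension of the quotient is the difference and the subtraction never truncates.\<close>

definition hilb_fun :: "poly3 set \<Rightarrow> nat \<Rightarrow> nat" where
  "hilb_fun J k = cvs.dim (forms k) - cvs.dim (J \<inter> forms k)"

definition h_gen :: "nat \<Rightarrow> nat \<Rightarrow> nat" where
  "h_gen r k = min r (cvs.dim (forms k))"

text \<open>Closed points of \<open>Hilb\<^sub>S\<^sup>h\<close>.\<close>

definition mHilb :: "(nat \<Rightarrow> nat) \<Rightarrow> poly3 set set" where
  "mHilb h = {J. homogeneous_ideal J \<and> (\<forall>k. hilb_fun J k = h k)}"

text \<open>The Pluecker coordinate, with respect to the monomials \<open>ms\<close>, of the subspace with ordered
  basis \<open>ws\<close>: the determinant (Leibniz formula) of the matrix of coefficients.\<close>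

definition pluecker :: "poly3 list \<Rightarrow> mono3 list \<Rightarrow> complex" where
  "pluecker ws ms = (if length ms = length ws
     then \<Sum>\<sigma> | \<sigma> permutes {..<length ws}. of_int (sign \<sigma>) *
       (\<Prod>i<length ws. Poly_Mapping.lookup (ws ! i) (ms ! \<sigma> i))
     else 0)"

definition basis_list :: "poly3 list \<Rightarrow> poly3 set \<Rightarrow> bool" where
  "basis_list ws V \<longleftrightarrow> distinct ws \<and> cvs.independent (set ws) \<and> cvs.span (set ws) = V"

text \<open>The Zariski topology on the closed points of \<open>Hilb\<^sub>S\<^sup>h\<close>, which is a closed subscheme of a
  product of Grassmannians via \<open>J \<mapsto> (J\<^sub>k)\<^sub>k\<close> for \<open>k\<close> in a finite set of degrees. A polynomial \<open>p\<close>
  in the Pluecker coordinates, indexed by a degree and a list of monomials, involves only finitely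
  many degrees. Quantifying over all bases of the \<open>J\<^sub>k\<close> rescales the coordinates of each degree
  independently, so \<open>p\<close> vanishes for all choices of bases iff all its multihomogeneous components
  vanish; hence the generating sets are exactly the finite unions of complements of
  multiprojective hypersurfaces.\<close>

definition zariski_mHilb :: "(nat \<Rightarrow> nat) \<Rightarrow> poly3 set topology" where
  "zariski_mHilb h = topology_generated_by
     {{J \<in> mHilb h. \<exists>w. (\<forall>k. basis_list (w k) (J \<inter> forms k)) \<and>
        insertion (\<lambda>(k, ms). pluecker (w k) ms) p \<noteq> 0} | p. True}"

text \<open>Points of \<open>\<P>\<^sup>2\<close> are lines through the origin with the origin removed.\<close>

definition proj_point :: "(3 \<Rightarrow> complex) \<Rightarrow> (3 \<Rightarrow> complex) set" where
  "proj_point v = {\<lambda>i. t * v i | t. t \<noteq> 0}"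

definition P2 :: "(3 \<Rightarrow> complex) set set" where
  "P2 = {proj_point v | v. v \<noteq> (\<lambda>_. 0)}"

definition vanishing_ideal :: "(3 \<Rightarrow> complex) set set \<Rightarrow> poly3 set" where
  "vanishing_ideal \<Gamma> = {f. \<forall>k. \<forall>L\<in>\<Gamma>. \<forall>v\<in>L. insertion v (hom_part k f) = 0}"

text \<open>The saturated ideal of a reduced set of points is its vanishing ideal.\<close>

definition Slip :: "nat \<Rightarrow> poly3 set set" where
  "Slip r = zariski_mHilb (h_gen r) closure_of
     {J \<in> mHilb (h_gen r). \<exists>\<Gamma>\<subseteq>P2. finite \<Gamma> \<and> card \<Gamma> = r \<and> J = vanishing_ideal \<Gamma>}"

section \<open>Closed subschemes of the projective plane\<close>

text \<open>A closed subscheme of \<open>\<P>\<^sup>2\<close> is a quasi-coherent ideal sheaf, i.e. an ideal \<open>Z i\<close> in the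
  coordinate ring \<open>(S\<^bsub>y\<^sub>i\<^esub>)\<^sub>0\<close> of each standard chart \<open>D\<^sub>+(y\<^sub>i)\<close> such that \<open>Z i\<close> and \<open>Z j\<close> extend
  to the same ideal on the overlap. The ring \<open>(S\<^bsub>y\<^sub>i\<^esub>)\<^sub>0\<close> is identified with the polynomials not
  involving \<open>y\<^sub>i\<close>, the fraction \<open>f / y\<^sub>i\<^sup>k\<close> with \<open>f \<in> S\<^sub>k\<close> corresponding to \<open>dehom i f\<close>, that is
  \<open>f\<close> with \<open>y\<^sub>i\<close> set to 1.\<close>

definition dehom :: "3 \<Rightarrow> poly3 \<Rightarrow> poly3" where
  "dehom i f = (\<Sum>m\<in>Poly_Mapping.keys f.
     Poly_Mapping.single (Poly_Mapping.update i 0 m) (Poly_Mapping.lookup f m))"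

definition chart :: "3 \<Rightarrow> poly3 set" where
  "chart i = {f. \<forall>m\<in>Poly_Mapping.keys f. Poly_Mapping.lookup m i = 0}"

definition chart_ideal :: "3 \<Rightarrow> poly3 set \<Rightarrow> bool" where
  "chart_ideal i I \<longleftrightarrow> I \<subseteq> chart i \<and> 0 \<in> I \<and> (\<forall>f\<in>I. \<forall>g\<in>I. f + g \<in> I) \<and>
     (\<forall>f\<in>chart i. \<forall>g\<in>I. f * g \<in> I)"

text \<open>On \<open>D\<^sub>+(y\<^sub>i y\<^sub>j)\<close>, for \<open>f \<in> S\<^sub>k\<close>, the section \<open>f / y\<^sub>i\<^sup>k\<close> lies in the extension of \<open>Z i\<close> iff
  \<open>(y\<^sub>j / y\<^sub>i)\<^sup>n f / y\<^sub>i\<^sup>k \<in> Z i\<close> for some \<open>n\<close>, and the sections \<open>f / y\<^sub>i\<^sup>k\<close> and \<open>f / y\<^sub>j\<^sup>k\<close> differ by a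
  unit; up to units every section on the overlap is of this form.\<close>

definition closed_subscheme :: "(3 \<Rightarrow> poly3 set) \<Rightarrow> bool" where
  "closed_subscheme Z \<longleftrightarrow> (\<forall>i. chart_ideal i (Z i)) \<and>
     (\<forall>i j k. \<forall>f\<in>forms k. (\<exists>n. dehom i (X j ^ n * f) \<in> Z i) \<longleftrightarrow>
                          (\<exists>n. dehom j (X i ^ n * f) \<in> Z j))"

text \<open>\<open>Proj (S/J)\<close>, given by the ideals \<open>(J\<^bsub>y\<^sub>i\<^esub>)\<^sub>0\<close>.\<close>

definition Proj_quot :: "poly3 set \<Rightarrow> (3 \<Rightarrow> poly3 set)" where
  "Proj_quot J = (\<lambda>i. {dehom i f | f k. f \<in> J \<inter> forms k})"

text \<open>The saturated ideal \<open>I\<^sub>Z = \<Oplus>\<^sub>k H\<^sup>0(\<P>\<^sup>2, \<I>\<^sub>Z(k))\<close>: the polynomials whose homogeneous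
  components restrict to sections of the ideal sheaf on every chart.\<close>

definition ideal_of :: "(3 \<Rightarrow> poly3 set) \<Rightarrow> poly3 set" where
  "ideal_of Z = {f. \<forall>k i. dehom i (hom_part k f) \<in> Z i}"

text \<open>Closed points of \<open>Hilb\<^sup>r(\<P>\<^sup>2)\<close>: subschemes with constant Hilbert polynomial \<open>r\<close>.\<close>

definition Hilb_P2 :: "nat \<Rightarrow> (3 \<Rightarrow> poly3 set) set" where
  "Hilb_P2 r = {Z. closed_subscheme Z \<and> (\<exists>N. \<forall>k\<ge>N. hilb_fun (ideal_of Z) k = r)}"

section \<open>Varieties of sums of powers\<close>

definition VPS :: "poly3 \<Rightarrow> nat \<Rightarrow> (3 \<Rightarrow> poly3 set) set" where
  "VPS F r = {Z \<in> Hilb_P2 r. ideal_of Z \<subseteq> Ann F}"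

text \<open>The border variety of sums of powers, underlined in the literature.\<close>

definition bVSP :: "poly3 \<Rightarrow> nat \<Rightarrow> poly3 set set" where
  "bVSP F r = {J \<in> Slip r. J \<subseteq> Ann F}"

text \<open>The preimage of \<open>VPS F r\<close> under \<open>\<phi>\<^sub>r : Slip r \<rightarrow> Hilb\<^sup>r(\<P>\<^sup>2), J \<mapsto> Proj (S/J)\<close>.\<close>

definition fiber_type :: "poly3 \<Rightarrow> nat \<Rightarrow> bool" where
  "fiber_type F r \<longleftrightarrow> bVSP F r = {J \<in> Slip r. Proj_quot J \<in> VPS F r}"

end

theory Submission
  imports Defs "Jordan_Normal_Form.Determinant"
begin

text \<open>Since \<open>a + b \<le> c\<close>, the monomial ideals \<open>Ann F\<close> and \<open>J = (y\<^sub>0\<^bsup>a+1\<^esup>, y\<^sub>1\<^bsup>b+1\<^esup>)\<close> agree in all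
  degrees up to \<open>c\<close>, and \<open>S/J\<close> has Hilbert function \<open>r\<close> from degree \<open>a + b\<close> on. Let \<open>I \<subseteq> Ann F\<close> be
  an ideal with \<open>dim (S/I)\<^bsub>a+b\<^esub> \<le> r\<close>; counting dimensions gives \<open>I = J\<close> in degree \<open>a + b\<close>, hence
  \<open>J \<subseteq> I\<close> in all degrees \<open>\<ge> a + b\<close>, with equality as soon as \<open>dim (S/I)\<^sub>k = r\<close>. For an ideal in
  \<open>Slip\<^sub>r\<close> the Hilbert function is given, and for the saturated ideal of a scheme of length \<open>r\<close> it is
  nondecreasing, because some linear form is a nonzerodivisor. Conversely an ideal defining the
  scheme of \<open>J\<close> lies in its saturation \<open>J \<subseteq> Ann F\<close>.

  The border rank is bounded below by an \<open>r \<times> r\<close> catalecticant minor that is diagonal for \<open>F\<close>, and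
  above by writing \<open>F\<close> as a limit of weighted sums of the powers
  \<open>(x\<^sub>2 + t \<zeta>\<^sup>i x\<^sub>0 + t \<xi>\<^sup>j x\<^sub>1)\<^sup>d\<close> with roots of unity \<open>\<zeta>, \<xi>\<close> of orders \<open>a + 1\<close> and \<open>b + 1\<close>.\<close>

text \<open>This simplification rule would re-associate products against \<open>mult.assoc\<close>.\<close>
declare idl.scale_scale [simp del]

abbreviation "lookup \<equiv> Poly_Mapping.lookup"
abbreviation "keys \<equiv> Poly_Mapping.keys"
abbreviation "single \<equiv> Poly_Mapping.single"

section \<open>Coefficients and scalar multiples\<close>

lemma lookup_smul [simp]: "lookup (smul c f) m = c * lookup f m"
  by (simp add: smul_def Poly_Mapping.map.rep_eq when_def flip: mult_map_scale_conv_mult)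

lemma smul_single: "smul c (single m d) = single m (c * d)"
  by (simp add: smul_def mult_single)

lemma smul_mult_right: "smul c (f * g) = f * smul c g"
  by (simp only: smul_def mult.left_commute)

lemma sum_single_lookup: "(\<Sum>m\<in>keys f. single m (lookup f m)) = f"
proof (rule poly_mapping_eqI)
  fix n
  show "lookup (\<Sum>m\<in>keys f. single m (lookup f m)) n = lookup f n"
    by (simp add: lookup_sum lookup_single when_def in_keys_iff)
qed

section \<open>Monomials\<close>

lemma mdeg_add: "mdeg (m + n) = mdeg m + mdeg n"
  by (simp add: mdeg_def lookup_add sum.distrib)

lemma mdeg_single [simp]: "mdeg (single i k) = k"
  by (simp add: mdeg_def lookup_single when_def)

lemma UNIV_three: "(UNIV :: 3 set) = {0, 1, 2}"
  using UNIV_3 by auto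

lemma sum_UNIV_three: "(\<Sum>i\<in>(UNIV :: 3 set). f i) = f 0 + f 1 + f 2"
  for f :: "3 \<Rightarrow> 'a :: comm_monoid_add"
  unfolding UNIV_three by (simp add: add.assoc)

lemma prod_UNIV_three: "(\<Prod>i\<in>(UNIV :: 3 set). f i) = f 0 * f 1 * f 2"
  for f :: "3 \<Rightarrow> 'a :: comm_monoid_mult"
  unfolding UNIV_three by (simp add: mult.assoc)

lemma forall_three: "(\<forall>i :: 3. P i) \<longleftrightarrow> P 0 \<and> P 1 \<and> P 2"
  by (metis UNIV_three UNIV_I empty_iff insert_iff)

definition expo :: "nat \<Rightarrow> nat \<Rightarrow> nat \<Rightarrow> mono3" where
  "expo i j k = single 0 i + single 1 j + single 2 k"

lemma lookup_expo [simp]: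
  "lookup (expo i j k) 0 = i" "lookup (expo i j k) 1 = j" "lookup (expo i j k) 2 = k"
  by (simp_all add: expo_def lookup_add lookup_single when_def)

lemma mono3_eqI:
  fixes m n :: mono3
  assumes "lookup m 0 = lookup n 0" "lookup m 1 = lookup n 1" "lookup m 2 = lookup n 2"
  shows "m = n"
proof (rule poly_mapping_eqI)
  fix i show "lookup m i = lookup n i"
    using assms forall_three[of "\<lambda>i. lookup m i = lookup n i"] by blast
qed

lemma expo_lookup: "expo (lookup m 0) (lookup m 1) (lookup m 2) = m"
  by (rule mono3_eqI) auto

lemma mdeg_eq: "mdeg m = lookup m 0 + lookup m 1 + lookup m 2"
  by (simp add: mdeg_def sum_UNIV_three)

lemma mdeg_expo [simp]: "mdeg (expo i j k) = i + j + k"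
  by (simp add: mdeg_eq)

lemma finite_mdeg: "finite {m. mdeg m = k}"
proof (rule finite_subset)
  show "{m. mdeg m = k} \<subseteq> (\<lambda>(i, j, l). expo i j l) ` ({..k} \<times> {..k} \<times> {..k})"
  proof
    fix m assume "m \<in> {m. mdeg m = k}"
    then have "m = (\<lambda>(i, j, l). expo i j l) (lookup m 0, lookup m 1, lookup m 2)"
      "(lookup m 0, lookup m 1, lookup m 2) \<in> {..k} \<times> {..k} \<times> {..k}"
      by (auto simp: expo_lookup mdeg_eq)
    then show "m \<in> (\<lambda>(i, j, l). expo i j l) ` ({..k} \<times> {..k} \<times> {..k})" by (rule image_eqI)
  qed
qed auto

lemma X_power: "X i ^ n = single (single i n) 1"
  by (induction n) (simp_all add: X_def mult_single flip: single_add)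

lemma mono3_diff_add:
  assumes "\<And>i. lookup n i \<le> lookup m i"
  shows "m - n + n = (m :: mono3)"
  by (rule poly_mapping_eqI) (simp add: lookup_add lookup_minus assms)

section \<open>Homogeneous components\<close>

lemma forms_iff: "f \<in> forms k \<longleftrightarrow> (\<forall>m. lookup f m \<noteq> 0 \<longrightarrow> mdeg m = k)"
  by (auto simp: forms_def in_keys_iff)

lemma single_in_forms: "mdeg m = k \<Longrightarrow> single m c \<in> forms k"
  by (auto simp: forms_def)

lemma zero_in_forms [simp]: "0 \<in> forms k"
  by (simp add: forms_def)

lemma add_in_forms: "f \<in> forms k \<Longrightarrow> g \<in> forms k \<Longrightarrow> f + g \<in> forms k"
  using keys_add by (fastforce simp: forms_def)

lemma smul_in_forms: "f \<in> forms k \<Longrightarrow> smul c f \<in> forms k"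
  by (auto simp: forms_iff)

lemma subspace_forms: "cvs.subspace (forms k)"
  by (simp add: cvs.subspace_def add_in_forms smul_in_forms)

lemma mult_in_forms: "f \<in> forms k \<Longrightarrow> g \<in> forms l \<Longrightarrow> f * g \<in> forms (k + l)"
  using keys_mult[of f g] by (fastforce simp: forms_def mdeg_add)

lemma X_power_in_forms: "X i ^ n \<in> forms n"
  by (simp add: X_power single_in_forms)

lemma X_in_forms: "X i \<in> forms 1"
  by (simp add: X_def single_in_forms)

lemma power_in_forms: "f \<in> forms k \<Longrightarrow> f ^ n \<in> forms (n * k)"
proof (induction n)
  case 0
  show ?case using X_power_in_forms[of 0 0] by simp
next
  case (Suc n)
  then show ?case using mult_in_forms[of f k "f ^ n" "n * k"] by simp
qed

lemma lookup_hom_part: "lookup (hom_part k f) m = (if mdeg m = k then lookup f m else 0)"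
proof -
  have "lookup (hom_part k f) m
      = (\<Sum>n\<in>{m\<in>keys f. mdeg m = k}. if n = m then lookup f n else 0)"
    by (simp add: hom_part_def lookup_sum lookup_single when_def)
  then show ?thesis by (auto simp: in_keys_iff)
qed

lemma hom_part_in_forms: "hom_part k f \<in> forms k"
  by (simp add: forms_iff lookup_hom_part)

lemma hom_part_form: "f \<in> forms k \<Longrightarrow> hom_part j f = (if j = k then f else 0)"
  by (rule poly_mapping_eqI) (auto simp: lookup_hom_part forms_iff)

lemma hom_part_zero [simp]: "hom_part k 0 = 0"
  by (rule poly_mapping_eqI) (simp add: lookup_hom_part)

lemma hom_part_add: "hom_part k (f + g) = hom_part k f + hom_part k g"
  by (rule poly_mapping_eqI) (simp add: lookup_hom_part lookup_add)

lemma hom_part_sum: "hom_part k (\<Sum>x\<in>A. f x) = (\<Sum>x\<in>A. hom_part k (f x))"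
  by (induction A rule: infinite_finite_induct) (simp_all add: hom_part_add)

text \<open>Multiplication by a term shifts the grading by its degree; this is how
  \<open>ideal_of Z\<close> is shown to be closed under multiplication.\<close>

lemma hom_part_single_mult:
  "hom_part k (single m c * f) = (if mdeg m \<le> k then single m c * hom_part (k - mdeg m) f else 0)"
proof -
  have eq: "single m c * f = (\<Sum>n\<in>keys f. single (m + n) (c * lookup f n))"
    by (subst sum_single_lookup[of f, symmetric]) (simp add: sum_distrib_left mult_single)
  have "hom_part k (single m c * f)
      = (\<Sum>n\<in>keys f. if k = mdeg m + mdeg n then single (m + n) (c * lookup f n) else 0)"
    unfolding eq hom_part_sum
    by (intro sum.cong refl) (simp add: hom_part_form[OF single_in_forms[OF mdeg_add]])
  also have "\<dots> = (if mdeg m \<le> k then single m c * hom_part (k - mdeg m) f else 0)"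
    by (auto simp: hom_part_def sum_distrib_left mult_single sum.If_cases intro!: sum.mono_neutral_cong_right sum.neutral)
  finally show ?thesis .
qed

section \<open>Monomial substitutions and dehomogenization\<close>

text \<open>The linear extension of a map on monomials. Dehomogenization and homogenization are both
  instances and share the rules below.\<close>

definition push :: "(mono3 \<Rightarrow> mono3) \<Rightarrow> poly3 \<Rightarrow> poly3" where
  "push \<phi> f = (\<Sum>m\<in>keys f. single (\<phi> m) (lookup f m))"

lemma push_superset:
  assumes "finite A" "keys f \<subseteq> A"
  shows "push \<phi> f = (\<Sum>m\<in>A. single (\<phi> m) (lookup f m))"
  unfolding push_def using assms
  by (intro sum.mono_neutral_left) (auto simp: in_keys_iff)

lemma push_zero [simp]: "push \<phi> 0 = 0"
  by (simp add: push_def)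

lemma push_single [simp]: "push \<phi> (single m c) = single (\<phi> m) c"
  by (subst push_superset[of "{m}"]) auto

lemma push_add: "push \<phi> (f + g) = push \<phi> f + push \<phi> g"
proof -
  have "keys (f + g) \<subseteq> keys f \<union> keys g" by (rule keys_add)
  then show ?thesis
    by (simp add: push_superset[of "keys f \<union> keys g"] lookup_add single_add sum.distrib)
qed

lemma push_sum: "push \<phi> (\<Sum>x\<in>A. f x) = (\<Sum>x\<in>A. push \<phi> (f x))"
  by (induction A rule: infinite_finite_induct) (simp_all add: push_add)

lemma push_push: "push \<phi> (push \<psi> f) = push (\<phi> \<circ> \<psi>) f"
  by (simp add: push_def[of \<psi>] push_def[of "\<phi> \<circ> \<psi>"] push_sum)

lemma push_ident: "(\<And>m. m \<in> keys f \<Longrightarrow> \<phi> m = m) \<Longrightarrow> push \<phi> f = f"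
  by (simp add: push_def sum_single_lookup)

lemma keys_push: "keys (push \<phi> f) \<subseteq> \<phi> ` keys f"
proof -
  have "keys (push \<phi> f) \<subseteq> (\<Union>m\<in>keys f. keys (single (\<phi> m) (lookup f m)))"
    unfolding push_def by (rule keys_sum)
  also have "\<dots> \<subseteq> \<phi> ` keys f" by auto
  finally show ?thesis .
qed

lemma push_mult:
  assumes "\<And>m n. \<phi> (m + n) = \<phi> m + \<phi> n"
  shows "push \<phi> (f * g) = push \<phi> f * push \<phi> g"
proof -
  have "f * g = (\<Sum>m\<in>keys f. single m (lookup f m)) * (\<Sum>n\<in>keys g. single n (lookup g n))"
    by (simp add: sum_single_lookup)
  also have "\<dots> = (\<Sum>m\<in>keys f. \<Sum>n\<in>keys g. single (m + n) (lookup f m * lookup g n))"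
    by (simp add: sum_product mult_single)
  finally show ?thesis
    by (simp add: push_sum push_def[of _ f] push_def[of _ g] sum_product mult_single assms)
qed

lemma dehom_eq_push: "dehom i = push (Poly_Mapping.update i 0)"
  by (rule ext) (simp add: dehom_def push_def)

lemma update_zero_add:
  "Poly_Mapping.update i 0 (m + n) = Poly_Mapping.update i 0 m + Poly_Mapping.update i 0 (n :: mono3)"
  by (rule poly_mapping_eqI) (simp add: lookup_update lookup_add)

lemma dehom_add: "dehom i (f + g) = dehom i f + dehom i g"
  by (simp add: dehom_eq_push push_add)

lemma dehom_mult: "dehom i (f * g) = dehom i f * dehom i g"
  by (simp add: dehom_eq_push push_mult update_zero_add)

lemma dehom_zero [simp]: "dehom i 0 = 0"
  by (simp add: dehom_eq_push)

lemma dehom_one [simp]: "dehom i 1 = 1"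
proof -
  have "Poly_Mapping.update i 0 (0 :: mono3) = 0"
    by (rule poly_mapping_eqI) (simp add: lookup_update)
  then show ?thesis
    using push_single[of "Poly_Mapping.update i 0" 0 1] by (simp add: dehom_eq_push)
qed

lemma dehom_power: "dehom i (f ^ n) = dehom i f ^ n"
  by (induction n) (simp_all add: dehom_mult)

lemma dehom_X_self [simp]: "dehom i (X i) = 1"
proof -
  have "Poly_Mapping.update i 0 (single i 1) = (0 :: mono3)"
    by (rule poly_mapping_eqI) (simp add: lookup_update lookup_single when_def)
  then show ?thesis by (simp add: dehom_eq_push X_def)
qed

lemma dehom_in_chart: "dehom i f \<in> chart i"
  using keys_push[of "Poly_Mapping.update i 0" f]
  by (auto simp: chart_def dehom_eq_push lookup_update)

text \<open>A homogenization only if \<open>k\<close> bounds the degrees that occur; otherwise the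
  subtraction truncates.\<close>

definition homogenize :: "3 \<Rightarrow> nat \<Rightarrow> poly3 \<Rightarrow> poly3" where
  "homogenize i k = push (\<lambda>m. m + single i (k - mdeg m))"

text \<open>The exponent lost by dehomogenizing is recovered from the total degree, so
  \<open>dehom\<close> is injective within one degree.\<close>

lemma homogenize_dehom: "f \<in> forms k \<Longrightarrow> homogenize i k (dehom i f) = f"
  unfolding homogenize_def dehom_eq_push push_push
proof (rule push_ident)
  fix m assume "f \<in> forms k" "m \<in> keys f"
  then have "mdeg m = k" by (simp add: forms_def)
  moreover have "Poly_Mapping.update i 0 m + single i (lookup m i) = m"
    by (rule poly_mapping_eqI) (simp add: lookup_update lookup_add lookup_single when_def)
  moreover from this have "mdeg m = mdeg (Poly_Mapping.update i 0 m) + lookup m i"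
    by (metis mdeg_add mdeg_single)
  ultimately have "k - mdeg (Poly_Mapping.update i 0 m) = lookup m i"
    by simp
  then show "((\<lambda>m. m + single i (k - mdeg m)) \<circ> Poly_Mapping.update i 0) m = m"
    using \<open>Poly_Mapping.update i 0 m + single i (lookup m i) = m\<close> by simp
qed

lemma dehom_inj: "f \<in> forms k \<Longrightarrow> g \<in> forms k \<Longrightarrow> dehom i f = dehom i g \<Longrightarrow> f = g"
  by (metis homogenize_dehom)

lemma dehom_surj:
  assumes "f \<in> chart i"
  shows "\<exists>k g. g \<in> forms k \<and> dehom i g = f"
proof -
  obtain k where k: "\<And>m. m \<in> keys f \<Longrightarrow> mdeg m \<le> k"
    using finite_nat_set_iff_bounded_le[of "mdeg ` keys f"] by auto
  have "homogenize i k f \<in> forms k"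
    using keys_push[of "\<lambda>m. m + single i (k - mdeg m)" f] k
    by (fastforce simp: forms_def homogenize_def mdeg_add)
  moreover have "dehom i (homogenize i k f) = f"
    unfolding homogenize_def dehom_eq_push push_push
  proof (rule push_ident)
    fix m assume "m \<in> keys f"
    then have "lookup m i = 0" using assms by (simp add: chart_def)
    then show "(Poly_Mapping.update i 0 \<circ> (\<lambda>m. m + single i (k - mdeg m))) m = m"
      by (intro poly_mapping_eqI) (auto simp: lookup_update lookup_add lookup_single when_def)
  qed
  ultimately show ?thesis by blast
qed

section \<open>Monomial ideals and apolarity\<close>

lemma partial_deriv_single:
  "partial_deriv i (single m c) = single (m - single i 1) (of_nat (lookup m i) * c)"
  by (cases "c = 0") (simp_all add: partial_deriv_def)

text \<open>The coefficient is a falling factorial; when \<open>n\<close> exceeds the exponent of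
  variable \<open>i\<close>, one factor is zero and the truncated exponent does no harm.\<close>

lemma partial_deriv_funpow_single:
  "(partial_deriv i ^^ n) (single m c)
     = single (m - single i n) (of_nat (\<Prod>j<n. lookup m i - j) * c)"
proof (induction n)
  case (Suc n)
  have "m - single i n - single i 1 = m - single i (Suc n)"
    by (rule poly_mapping_eqI) (simp add: lookup_minus lookup_single when_def)
  with Suc show ?case
    by (simp add: partial_deriv_single lookup_minus mult_ac)
qed simp

lemma act_single:
  "act \<psi> (single m 1) = (\<Sum>\<alpha>\<in>keys \<psi>. single (m - \<alpha>)
     (lookup \<psi> \<alpha> * of_nat (\<Prod>i\<in>UNIV. \<Prod>j<lookup \<alpha> i. lookup m i - j)))"
proof -
  have eq: "m - single 2 (lookup \<alpha> 2) - single 1 (lookup \<alpha> 1) - single 0 (lookup \<alpha> 0) = m - \<alpha>"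
    for \<alpha> :: mono3
    by (rule mono3_eqI) (simp_all add: lookup_minus lookup_single when_def)
  show ?thesis
    unfolding act_def partial_deriv_funpow_single smul_single eq prod_UNIV_three
    by (intro sum.cong refl arg_cong[of _ _ "single _"])
       (simp add: lookup_minus lookup_single when_def mult_ac)
qed

text \<open>Monomials dividing \<open>m\<close> differentiate it to nonzero multiples of distinct
  monomials, and all others annihilate it, so nothing can cancel.\<close>

lemma Ann_single: "Ann (single m 1) = {\<psi>. \<forall>\<alpha>\<in>keys \<psi>. \<exists>i. lookup m i < lookup \<alpha> i}"
proof (intro Set.set_eqI iffI; clarsimp simp: Ann_def)
  fix \<psi> \<alpha> assume act: "act \<psi> (single m 1) = 0" and \<alpha>: "\<alpha> \<in> keys \<psi>"
  show "\<exists>i. lookup m i < lookup \<alpha> i"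
  proof (rule ccontr)
    assume "\<not> (\<exists>i. lookup m i < lookup \<alpha> i)"
    then have le: "lookup \<alpha> i \<le> lookup m i" for i by (simp add: not_less)
    define P where "P \<beta> = (\<Prod>i\<in>UNIV. \<Prod>j<lookup \<beta> i. lookup m i - j)" for \<beta> :: mono3
    \<comment> \<open>Truncated subtraction can send another \<open>\<beta>\<close> to the same
      exponent \<open>m - \<alpha>\<close>; such a \<open>\<beta>\<close> exceeds \<open>m\<close>
      in some variable, where its falling factorial vanishes.\<close>
    have P0: "P \<beta> = 0" if neq: "\<beta> \<noteq> \<alpha>" and eq: "m - \<beta> = m - \<alpha>" for \<beta>
    proof -
      obtain i where i: "lookup \<beta> i \<noteq> lookup \<alpha> i"
        using neq by (auto simp: poly_mapping_eq_iff fun_eq_iff)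
      have "lookup m i - lookup \<beta> i = lookup m i - lookup \<alpha> i"
        using eq by (metis lookup_minus)
      with i le[of i] have "lookup m i < lookup \<beta> i" by linarith
      then show ?thesis unfolding P_def
        by (intro prod_zero finite bexI[of _ i]) (auto intro: prod_zero)
    qed
    have "0 = lookup (act \<psi> (single m 1)) (m - \<alpha>)" by (simp add: act)
    also have "\<dots> = (\<Sum>\<beta>\<in>keys \<psi>. if \<beta> = \<alpha> then lookup \<psi> \<alpha> * of_nat (P \<alpha>) else 0)"
      unfolding act_single lookup_sum
      by (intro sum.cong refl) (auto simp: lookup_single when_def P_def[symmetric] P0)
    also have "\<dots> = lookup \<psi> \<alpha> * of_nat (P \<alpha>)" using \<alpha> by simp
    finally have "P \<alpha> = 0" using \<alpha> by (simp add: in_keys_iff)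
    then obtain i j where "j < lookup \<alpha> i" "lookup m i - j = 0" by (auto simp: P_def)
    with le[of i] show False by linarith
  qed
next
  fix \<psi> :: poly3 assume *: "\<forall>\<alpha>\<in>keys \<psi>. \<exists>i. lookup m i < lookup \<alpha> i"
  have "(\<Prod>i\<in>UNIV. \<Prod>j<lookup \<alpha> i. lookup m i - j) = 0" if "\<alpha> \<in> keys \<psi>" for \<alpha>
    using * that by (intro prod_zero) (auto intro!: prod_zero bexI)
  then show "act \<psi> (single m 1) = 0"
    unfolding act_single by (intro sum.neutral ballI) (simp only: of_nat_0 mult_zero_right single_zero)
qed

text \<open>The ideal generated by \<open>X 0 ^ (a + 1)\<close> and \<open>X 1 ^ (b + 1)\<close>,
  encoded by exponents so that its graded pieces are spanned by monomials and dimensions become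
  counts.\<close>

definition ci_ideal :: "nat \<Rightarrow> nat \<Rightarrow> poly3 set" where
  "ci_ideal a b = {f. \<forall>m\<in>keys f. a < lookup m 0 \<or> b < lookup m 1}"

lemma subspace_ci_ideal: "idl.subspace (ci_ideal a b)"
  unfolding idl.subspace_def
proof (intro conjI ballI allI)
  fix f g assume "f \<in> ci_ideal a b" "g \<in> ci_ideal a b"
  then show "f + g \<in> ci_ideal a b" using keys_add[of f g] by (fastforce simp: ci_ideal_def)
next
  fix f g assume g: "g \<in> ci_ideal a b"
  show "f * g \<in> ci_ideal a b" unfolding ci_ideal_def
  proof clarify
    fix m assume "m \<in> keys (f * g)" "\<not> b < lookup m 1"
    then obtain n n' where "m = n + n'" "n' \<in> keys g" using keys_mult[of f g] by blast
    with g \<open>\<not> b < lookup m 1\<close> show "a < lookup m 0" by (force simp: ci_ideal_def lookup_add)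
  qed
qed (simp add: ci_ideal_def)

lemma span_eq_ci_ideal: "idl.span {X 0 ^ (a + 1), X 1 ^ (b + 1)} = ci_ideal a b"
proof
  show "idl.span {X 0 ^ (a + 1), X 1 ^ (b + 1)} \<subseteq> ci_ideal a b"
    by (rule idl.span_minimal[OF _ subspace_ci_ideal])
       (auto simp: ci_ideal_def X_power simp del: power_Suc)
next
  show "ci_ideal a b \<subseteq> idl.span {X 0 ^ (a + 1), X 1 ^ (b + 1)}"
  proof
    fix f assume f: "f \<in> ci_ideal a b"
    have "single m c \<in> idl.span {X 0 ^ (a + 1), X 1 ^ (b + 1)}" if "m \<in> keys f" for m c
    proof -
      have *: "single m c = single (m - single i n) c * X i ^ n" if "n \<le> lookup m i" for i n
      proof -
        have "m - single i n + single i n = m"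
          by (rule mono3_diff_add) (use that in \<open>auto simp: lookup_single when_def\<close>)
        then show ?thesis by (simp add: X_power mult_single)
      qed
      from that f have "a + 1 \<le> lookup m 0 \<or> b + 1 \<le> lookup m 1" by (auto simp: ci_ideal_def)
      then show ?thesis
        by (metis * idl.span_base idl.span_scale insertCI)
    qed
    then have "(\<Sum>m\<in>keys f. single m (lookup f m)) \<in> idl.span {X 0 ^ (a + 1), X 1 ^ (b + 1)}"
      by (intro idl.span_sum)
    then show "f \<in> idl.span {X 0 ^ (a + 1), X 1 ^ (b + 1)}" by (simp only: sum_single_lookup)
  qed
qed

lemma monomial_eq_single: "X 0 ^ a * X 1 ^ b * X 2 ^ c = single (expo a b c) 1"
  by (simp add: X_power mult_single expo_def)

lemma ci_ideal_subset_Ann: "ci_ideal a b \<subseteq> Ann (single (expo a b c) 1)"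
  by (fastforce simp: Ann_single ci_ideal_def intro: exI[of _ "0::3"] exI[of _ "1::3"])

text \<open>The remaining generator of the annihilator, \<open>X 2 ^ (c + 1)\<close>, has degree
  above \<open>c\<close>.\<close>

lemma Ann_forms_subset_ci_ideal:
  assumes "k \<le> c"
  shows "Ann (single (expo a b c) 1) \<inter> forms k \<subseteq> ci_ideal a b"
proof clarify
  fix f assume f: "f \<in> Ann (single (expo a b c) 1)" "f \<in> forms k"
  show "f \<in> ci_ideal a b" unfolding ci_ideal_def
  proof clarify
    fix m assume m: "m \<in> keys f" "\<not> b < lookup m 1"
    then obtain i where i: "lookup (expo a b c) i < lookup m i" using f by (auto simp: Ann_single)
    have "lookup m 2 \<le> c" using m f assms by (auto simp: forms_def mdeg_eq)
    then show "a < lookup m 0"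
      using i m(2) forall_three[of "\<lambda>i. lookup m i \<le> lookup (expo a b c) i"]
      by (metis lookup_expo not_less)
  qed
qed

section \<open>Dimensions\<close>

text \<open>The polynomial ring has infinite dimension, so a finite spanning set \<open>T\<close> is
  what makes the bases finite.\<close>

lemma cvs_dim_mono:
  assumes "W \<subseteq> U" "U \<subseteq> cvs.span T" "finite T"
  shows "cvs.dim W \<le> cvs.dim U"
    and "cvs.subspace W \<Longrightarrow> cvs.dim U \<le> cvs.dim W \<Longrightarrow> W = U"
proof -
  obtain B where B: "B \<subseteq> W" "cvs.independent B" "W \<subseteq> cvs.span B" "card B = cvs.dim W"
    by (rule cvs.basis_exists)
  have "B \<subseteq> U" using B(1) assms(1) by blast
  then obtain C where C: "B \<subseteq> C" "C \<subseteq> U" "cvs.independent C" "U \<subseteq> cvs.span C"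
    using cvs.maximal_independent_subset_extend[OF _ B(2)] by blast
  have fin: "finite C"
    using cvs.independent_span_bound[OF assms(3) C(3)] C(2) assms(2) by blast
  have card: "card C = cvs.dim U" by (rule cvs.basis_card_eq_dim[OF C(2,4,3)])
  show "cvs.dim W \<le> cvs.dim U" using card_mono[OF fin C(1)] B(4) card by simp
  assume W: "cvs.subspace W" and le: "cvs.dim U \<le> cvs.dim W"
  have "B = C" using card_seteq[OF fin C(1)] le B(4) card by simp
  then have "U \<subseteq> W" using C(4) cvs.span_minimal[OF B(1) W] by blast
  with assms(1) show "W = U" by blast
qed

lemma monomials_span: "{f. keys f \<subseteq> M} \<subseteq> cvs.span ((\<lambda>m. single m (1::complex)) ` M)"
proof clarify
  fix f :: poly3 assume f: "keys f \<subseteq> M"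
  have "(\<Sum>m\<in>keys f. smul (lookup f m) (single m 1)) \<in> cvs.span ((\<lambda>m. single m (1::complex)) ` M)"
    using f by (intro cvs.span_sum cvs.span_scale cvs.span_base) auto
  then show "f \<in> cvs.span ((\<lambda>m. single m (1::complex)) ` M)" by (simp add: smul_single sum_single_lookup)
qed

lemma dim_monomials:
  assumes "finite M"
  shows "cvs.dim {f. keys f \<subseteq> M} = card M"
proof -
  have inj: "inj_on (\<lambda>m. single m (1::complex)) M"
    by (rule inj_onI) (metis lookup_single_eq lookup_single_not_eq zero_neq_one)
  have "cvs.independent ((\<lambda>m. single m (1::complex)) ` M)"
  proof (rule cvs.independent_if_scalars_zero)
    fix g x assume sum: "(\<Sum>x\<in>(\<lambda>m. single m (1::complex)) ` M. smul (g x) x) = 0" and "x \<in> (\<lambda>m. single m (1::complex)) ` M"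
    then obtain m where m: "m \<in> M" "x = single m 1" by blast
    have "0 = lookup (\<Sum>n\<in>M. smul (g (single n 1)) (single n 1)) m"
      using sum by (simp add: sum.reindex[OF inj])
    also have "\<dots> = (\<Sum>n\<in>M. if n = m then g (single n 1) else 0)"
      unfolding lookup_sum by (intro sum.cong refl) (simp add: lookup_single when_def)
    finally show "g x = 0" using m assms by simp
  qed (use assms in auto)
  then have "card ((\<lambda>m. single m (1::complex)) ` M) = cvs.dim {f. keys f \<subseteq> M}"
    by (intro cvs.basis_card_eq_dim monomials_span) auto
  then show ?thesis by (simp add: card_image[OF inj])
qed

lemma forms_eq_monomials: "forms k = {f. keys f \<subseteq> {m. mdeg m = k}}"
  by (auto simp: forms_def)

lemma forms_finite_span: "\<exists>T. finite T \<and> forms k \<subseteq> cvs.span T"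
  unfolding forms_eq_monomials
  by (intro exI[of _ "(\<lambda>m. single m 1) ` {m. mdeg m = k}"] conjI monomials_span finite_imageI finite_mdeg)

lemma dim_le_dim_forms: "W \<subseteq> forms k \<Longrightarrow> cvs.dim W \<le> cvs.dim (forms k)"
  by (metis forms_finite_span cvs_dim_mono(1))

lemma finite_independent_forms: "B \<subseteq> forms k \<Longrightarrow> cvs.independent B \<Longrightarrow> finite B"
  by (metis forms_finite_span cvs.independent_span_bound subset_trans)

text \<open>Independence of the indexed family also makes \<open>v\<close> injective: two equal
  vectors would satisfy the relation with coefficients 1 and -1.\<close>

lemma card_le_dim_forms:
  assumes fin: "finite T" and v: "\<And>t. t \<in> T \<Longrightarrow> v t \<in> forms k"
    and indep: "\<And>c s. (\<Sum>t\<in>T. smul (c t) (v t)) = 0 \<Longrightarrow> s \<in> T \<Longrightarrow> c s = 0"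
  shows "card T \<le> cvs.dim (forms k)"
proof -
  have inj: "inj_on v T"
  proof (rule inj_onI, rule ccontr)
    fix s t assume st: "s \<in> T" "t \<in> T" "v s = v t" "s \<noteq> t"
    define c :: "'a \<Rightarrow> complex" where "c x = (if x = s then 1 else 0) - (if x = t then 1 else 0)" for x
    have "smul (c x) (v x) = (if x = s then v x else 0) - (if x = t then v x else 0)" for x
      by (simp add: c_def cvs.scale_left_diff_distrib)
    then have "(\<Sum>x\<in>T. smul (c x) (v x)) = 0"
      using st fin by (simp add: sum_subtractf)
    from indep[OF this st(1)] st(4) show False by (simp add: c_def)
  qed
  have "cvs.independent (v ` T)"
  proof (rule cvs.independent_if_scalars_zero)
    fix g x assume "(\<Sum>x\<in>v ` T. smul (g x) x) = 0" "x \<in> v ` T"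
    then show "g x = 0" using indep[of "\<lambda>t. g (v t)"] by (auto simp: sum.reindex[OF inj])
  qed (use fin in auto)
  then have "card (v ` T) = cvs.dim (v ` T)" by (simp add: cvs.dim_eq_card_independent)
  also have "\<dots> \<le> cvs.dim (forms k)" using v by (intro dim_le_dim_forms) auto
  finally show ?thesis by (simp add: card_image[OF inj])
qed

section \<open>Hilbert functions\<close>

lemma ideal_mult: "idl.subspace I \<Longrightarrow> f \<in> I \<Longrightarrow> g * f \<in> I"
  by (rule idl.subspace_scale)

lemma ideal_smul: "idl.subspace I \<Longrightarrow> f \<in> I \<Longrightarrow> smul c f \<in> I"
  by (simp add: smul_def ideal_mult)

lemma ideal_smul_cancel: "idl.subspace I \<Longrightarrow> smul c f \<in> I \<Longrightarrow> c \<noteq> 0 \<Longrightarrow> f \<in> I"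
  using ideal_smul[of I "smul c f" "inverse c"] by simp

lemma ideal_diff_cancel: "idl.subspace I \<Longrightarrow> f - g \<in> I \<Longrightarrow> g \<in> I \<Longrightarrow> f \<in> I"
  using idl.subspace_add[of I "f - g" g] by simp

lemma subspace_ideal_forms: "idl.subspace I \<Longrightarrow> cvs.subspace (I \<inter> forms k)"
  by (simp add: cvs.subspace_def idl.subspace_0 idl.subspace_add ideal_smul add_in_forms smul_in_forms)

lemma hilb_fun_monomials:
  assumes "J \<inter> forms k = {f. keys f \<subseteq> {m. mdeg m = k \<and> P m}}"
  shows "hilb_fun J k = card {m. mdeg m = k \<and> \<not> P m}"
proof -
  have "card {m. mdeg m = k \<and> \<not> P m} = card ({m. mdeg m = k} - {m. mdeg m = k \<and> P m})"
    by (rule arg_cong[of _ _ card]) auto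
  also have "\<dots> = card {m. mdeg m = k} - card {m. mdeg m = k \<and> P m}"
    by (intro card_Diff_subset) (auto intro: finite_subset[OF _ finite_mdeg[of k]])
  also have "\<dots> = hilb_fun J k"
    unfolding hilb_fun_def assms unfolding forms_eq_monomials
    by (subst (1 2) dim_monomials) (auto intro: finite_subset[OF _ finite_mdeg[of k]])
  finally show ?thesis by simp
qed

lemma ideal_forms_eqI:
  assumes "idl.subspace I" "I \<inter> forms k \<subseteq> J" "hilb_fun I k \<le> hilb_fun J k"
  shows "I \<inter> forms k = J \<inter> forms k"
proof -
  obtain T where T: "finite T" "forms k \<subseteq> cvs.span T" using forms_finite_span by blast
  have "cvs.dim (J \<inter> forms k) \<le> cvs.dim (I \<inter> forms k)"
    using assms(3) dim_le_dim_forms[of "J \<inter> forms k" k] dim_le_dim_forms[of "I \<inter> forms k" k]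
    by (simp add: hilb_fun_def)
  then show ?thesis
    using assms(2) T by (intro cvs_dim_mono(2)[OF _ _ T(1)] subspace_ideal_forms assms(1)) auto
qed

text \<open>The surviving monomials are given by first exponents up to \<open>a\<close> and
  \<open>b\<close>; the bound on \<open>k\<close> leaves a nonnegative exponent for the last
  variable.\<close>

lemma hilb_fun_ci_ideal:
  assumes "a + b \<le> k"
  shows "hilb_fun (ci_ideal a b) k = (a + 1) * (b + 1)"
proof -
  have "ci_ideal a b \<inter> forms k = {f. keys f \<subseteq> {m. mdeg m = k \<and> (a < lookup m 0 \<or> b < lookup m 1)}}"
    by (auto simp: ci_ideal_def forms_def)
  then have "hilb_fun (ci_ideal a b) k = card {m. mdeg m = k \<and> \<not> (a < lookup m 0 \<or> b < lookup m 1)}"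
    by (rule hilb_fun_monomials)
  also have "\<dots> = card ({..a} \<times> {..b})"
  proof (rule sym, rule bij_betw_same_card, rule bij_betw_byWitness)
    show "\<forall>x\<in>{..a} \<times> {..b}. (\<lambda>m. (lookup m 0, lookup m 1)) ((\<lambda>(i, j). expo i j (k - i - j)) x) = x"
      by auto
    show "\<forall>m\<in>{m. mdeg m = k \<and> \<not> (a < lookup m 0 \<or> b < lookup m 1)}.
        (\<lambda>(i, j). expo i j (k - i - j)) (lookup m 0, lookup m 1) = m"
      by (auto intro!: mono3_eqI simp: mdeg_eq)
  qed (use assms in auto)
  finally show ?thesis by simp
qed

text \<open>The quotient by the complete intersection already has dimension
  \<open>(a + 1) * (b + 1)\<close> in degree \<open>k\<close>, so \<open>forms k\<close> is at least
  that large.\<close>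

lemma h_gen_eq:
  assumes "a + b \<le> k"
  shows "h_gen ((a + 1) * (b + 1)) k = (a + 1) * (b + 1)"
  using hilb_fun_ci_ideal[OF assms] by (simp add: h_gen_def hilb_fun_def)

section \<open>Linear forms avoiding the associated primes\<close>

text \<open>Vectors annihilated modulo \<open>I\<close> by pairwise distinct members of the pencil
  \<open>l\<^sub>1 + t l\<^sub>2\<close> and by no power of \<open>(l\<^sub>1, l\<^sub>2)\<close> are linearly independent, like eigenvectors for
  distinct eigenvalues.\<close>

lemma finite_bad_pencil_members:
  assumes I: "idl.subspace I"
  shows "finite {t. \<exists>v\<in>forms k. (l1 + smul t l2) * v \<in> I \<and> \<not> (\<exists>n. l1 ^ n * v \<in> I \<and> l2 ^ n * v \<in> I)}"
    (is "finite ?bad")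
proof (rule ccontr)
  assume "infinite ?bad"
  \<comment> \<open>One bad parameter more than the dimension of \<open>forms k\<close>, whereas
    their vectors will turn out to be independent.\<close>
  then obtain T where T: "finite T" "card T = Suc (cvs.dim (forms k))" "T \<subseteq> ?bad"
    by (meson infinite_arbitrarily_large)
  then have "\<forall>t\<in>T. \<exists>v. v \<in> forms k \<and> (l1 + smul t l2) * v \<in> I \<and> \<not> (\<exists>n. l1 ^ n * v \<in> I \<and> l2 ^ n * v \<in> I)"
    by blast
  then obtain v where v: "\<And>t. t \<in> T \<Longrightarrow> v t \<in> forms k" "\<And>t. t \<in> T \<Longrightarrow> (l1 + smul t l2) * v t \<in> I"
    "\<And>t. t \<in> T \<Longrightarrow> \<not> (\<exists>n. l1 ^ n * v t \<in> I \<and> l2 ^ n * v t \<in> I)"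
    by metis
  have "card T \<le> cvs.dim (forms k)"
  proof (rule card_le_dim_forms[OF T(1) v(1)])
    fix c s assume sum0: "(\<Sum>t\<in>T. smul (c t) (v t)) = 0" and s: "s \<in> T"
    define P where "P A = (\<Prod>t\<in>A. l1 + smul t l2)" for A
    \<comment> \<open>Modulo \<open>I\<close>, \<open>l1 * v s\<close> equals \<open>- s\<close>
      times \<open>l2 * v s\<close>, so each factor \<open>l1 + smul t l2\<close> acts on
      \<open>v s\<close> as \<open>(t - s)\<close> times \<open>l2\<close>.\<close>
    have P: "P A * v s - smul (\<Prod>t\<in>A. t - s) (l2 ^ card A * v s) \<in> I" if "finite A" for A
      using that
    proof (induction A)
      case empty
      show ?case by (simp add: P_def idl.subspace_0[OF I])
    next
      case (insert t A)
      have ring: "(l1 + x * l2) * p * u - (x - y) * q * (l2 * r * u)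
          = (l1 + x * l2) * (p * u - q * (r * u)) + q * r * ((l1 + y * l2) * u)"
        for x y p q r u :: poly3
        by (simp add: algebra_simps)
      have "P (insert t A) * v s - smul (\<Prod>t\<in>insert t A. t - s) (l2 ^ card (insert t A) * v s)
          = (l1 + smul t l2) * (P A * v s - smul (\<Prod>t\<in>A. t - s) (l2 ^ card A * v s))
            + single 0 (\<Prod>t\<in>A. t - s) * l2 ^ card A * ((l1 + smul s l2) * v s)"
        using insert ring[of "single 0 t" "P A" "v s" "single 0 s" "single 0 (\<Prod>t\<in>A. t - s)" "l2 ^ card A"]
        by (simp add: P_def smul_def mult_single flip: single_diff)
      then show ?case using insert v(2)[OF s] by (simp add: idl.subspace_add[OF I] ideal_mult[OF I])
    qed
    have l1: "l1 ^ n * v s - smul ((- s) ^ n) (l2 ^ n * v s) \<in> I" for n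
    proof (induction n)
      case 0
      show ?case by (simp add: idl.subspace_0[OF I])
    next
      case (Suc n)
      have ring: "l1 * p * u - (- y) * q * (l2 * r * u)
          = l1 * (p * u - q * (r * u)) + q * r * ((l1 + y * l2) * u)"
        for y p q r u :: poly3
        by (simp add: algebra_simps)
      have "l1 ^ Suc n * v s - smul ((- s) ^ Suc n) (l2 ^ Suc n * v s)
          = l1 * (l1 ^ n * v s - smul ((- s) ^ n) (l2 ^ n * v s))
            + single 0 ((- s) ^ n) * l2 ^ n * ((l1 + smul s l2) * v s)"
        using ring[of "l1 ^ n" "v s" "single 0 s" "single 0 ((- s) ^ n)" "l2 ^ n"]
        by (simp add: smul_def mult_single flip: single_uminus)
      then show ?case using Suc v(2)[OF s] by (simp add: idl.subspace_add[OF I] ideal_mult[OF I])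
    qed
    show "c s = 0"
    proof (rule ccontr)
      assume c: "c s \<noteq> 0"
      \<comment> \<open>The product over \<open>T - {s}\<close> contains the factor annihilating
        \<open>v t\<close>, so it isolates the term at \<open>s\<close> in the relation.\<close>
      have "P (T - {s}) * smul (c t) (v t) \<in> I" if t: "t \<in> T - {s}" for t
      proof -
        have "P (T - {s}) = (l1 + smul t l2) * P (T - {s} - {t})"
          unfolding P_def using T(1) t by (intro prod.remove) auto
        then have "P (T - {s}) * smul (c t) (v t)
            = smul (c t) (P (T - {s} - {t}) * ((l1 + smul t l2) * v t))"
          by (simp add: smul_def ac_simps)
        then show ?thesis using v(2) t by (simp add: ideal_smul[OF I] ideal_mult[OF I])
      qed
      then have "(\<Sum>t\<in>T - {s}. P (T - {s}) * smul (c t) (v t)) \<in> I"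
        by (rule idl.subspace_sum[OF I])
      moreover have "P (T - {s}) * smul (c s) (v s) + (\<Sum>t\<in>T - {s}. P (T - {s}) * smul (c t) (v t))
          = P (T - {s}) * (\<Sum>t\<in>T. smul (c t) (v t))"
        using T(1) s by (simp add: sum.remove distrib_left sum_distrib_left)
      ultimately have "P (T - {s}) * smul (c s) (v s) \<in> I"
        using idl.subspace_neg[OF I] by (simp add: sum0 add_eq_0_iff2)
      then have "smul (c s) (P (T - {s}) * v s) \<in> I" by (simp add: smul_mult_right)
      then have "P (T - {s}) * v s \<in> I" using ideal_smul_cancel[OF I] c by blast
      with P[of "T - {s}"] T(1)
      have "smul (\<Prod>t\<in>T - {s}. t - s) (l2 ^ card (T - {s}) * v s) \<in> I"
        using idl.subspace_diff[OF I, of "P (T - {s}) * v s"] by fastforce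
      moreover have "(\<Prod>t\<in>T - {s}. t - s) \<noteq> 0" using T(1) by simp
      ultimately have l2: "l2 ^ card (T - {s}) * v s \<in> I" using ideal_smul_cancel[OF I] by blast
      \<comment> \<open>A power of \<open>l2\<close> annihilating \<open>v s\<close> modulo
        \<open>I\<close> forces the same power of \<open>l1\<close> to do so, contrary to the choice
        of \<open>v s\<close>.\<close>
      with l1[of "card (T - {s})"] have "l1 ^ card (T - {s}) * v s \<in> I"
        using ideal_diff_cancel[OF I] ideal_smul[OF I] by blast
      with l2 v(3)[OF s] show False by blast
    qed
  qed
  with T(2) show False by simp
qed

text \<open>The form is chosen in two pencils: \<open>l\<close> spanned by the first two variables,
  then \<open>l + smul s (X 2)\<close>. What it annihilates modulo \<open>I\<close> is annihilated
  by powers of all three variables, so saturation applies.\<close>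

lemma exists_regular_linear_form:
  assumes I: "idl.subspace I"
    and sat: "\<And>f. f \<in> forms k \<Longrightarrow> (\<And>i. \<exists>n. X i ^ n * f \<in> I) \<Longrightarrow> f \<in> I"
  shows "\<exists>l\<in>forms 1. \<forall>f\<in>forms k. l * f \<in> I \<longrightarrow> f \<in> I"
proof -
  define bad where "bad l1 l2 j = {t. \<exists>v\<in>forms j. (l1 + smul t l2) * v \<in> I \<and>
    \<not> (\<exists>n. l1 ^ n * v \<in> I \<and> l2 ^ n * v \<in> I)}" for l1 l2 j
  have fin: "finite (bad l1 l2 j)" for l1 l2 j
    unfolding bad_def by (rule finite_bad_pencil_members[OF I])
  \<comment> \<open>The parameter must be good in every degree, because powers of \<open>l\<close>
    raise the degree of \<open>v\<close>; countably many finite sets cannot exhaust the complex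
    numbers.\<close>
  have "countable (\<Union>j. bad (X 0) (X 1) j)" using fin by (simp add: countable_finite)
  then obtain t where t: "\<And>j. t \<notin> bad (X 0) (X 1) j"
    using uncountable_UNIV_complex by (metis UNIV_I UNIV_eq_I UN_I)
  define l where "l = X 0 + smul t (X 1)"
  have l: "\<exists>n. X 0 ^ n * v \<in> I \<and> X 1 ^ n * v \<in> I" if "v \<in> forms j" "l ^ m * v \<in> I" for m v j
    using that
  proof (induction m arbitrary: v j)
    case 0
    then show ?case by (intro exI[of _ 0]) simp
  next
    case (Suc m)
    have lin: "l \<in> forms 1" by (simp add: l_def add_in_forms smul_in_forms X_in_forms del: One_nat_def)
    have "l * (l ^ m * v) \<in> I" using Suc.prems by (simp add: mult.assoc)
    moreover have "l ^ m * v \<in> forms (m * 1 + j)"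
      using lin Suc.prems by (intro mult_in_forms power_in_forms)
    ultimately obtain n where n: "X 0 ^ n * (l ^ m * v) \<in> I" "X 1 ^ n * (l ^ m * v) \<in> I"
      using t[of "m * 1 + j"] unfolding bad_def l_def by blast
    \<comment> \<open>The induction hypothesis applies to \<open>X 0 ^ n * v\<close> and
      \<open>X 1 ^ n * v\<close>: one factor \<open>l\<close> has been traded for a power of a
      variable.\<close>
    have "\<exists>n'. X 0 ^ n' * (X i ^ n * v) \<in> I \<and> X 1 ^ n' * (X i ^ n * v) \<in> I" if "i = 0 \<or> i = 1" for i
      using n that Suc.prems(1)
      by (intro Suc.IH[of _ "n + j"] mult_in_forms X_power_in_forms) (auto simp: mult.left_commute)
    then obtain n0 n1 where "X 0 ^ n0 * (X 0 ^ n * v) \<in> I" "X 1 ^ n1 * (X 1 ^ n * v) \<in> I" by blast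
    then have "X 0 ^ n1 * (X 0 ^ n0 * (X 0 ^ n * v)) \<in> I" "X 1 ^ n0 * (X 1 ^ n1 * (X 1 ^ n * v)) \<in> I"
      by (auto intro: ideal_mult[OF I])
    then show ?case
      by (intro exI[of _ "n1 + n0 + n"]) (simp add: power_add ac_simps)
  qed
  have "\<not> bad l (X 2) k = UNIV" using fin[of l "X 2" k] by (metis infinite_UNIV_char_0)
  then obtain s where s: "s \<notin> bad l (X 2) k" by blast
  show ?thesis
  proof (intro bexI[of _ "l + smul s (X 2)"] ballI impI)
    show "l + smul s (X 2) \<in> forms 1"
      by (simp add: l_def add_in_forms smul_in_forms X_in_forms del: One_nat_def)
    fix f assume f: "f \<in> forms k" "(l + smul s (X 2)) * f \<in> I"
    then obtain n where n: "l ^ n * f \<in> I" "X 2 ^ n * f \<in> I" using s unfolding bad_def by blast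
    from l[OF f(1) n(1)] n(2) have "\<forall>i. \<exists>n. X i ^ n * f \<in> I" unfolding forall_three by blast
    then show "f \<in> I" using sat f(1) by blast
  qed
qed

text \<open>Multiplication by \<open>l\<close> embeds degree \<open>k\<close> of \<open>S/I\<close>
  into degree \<open>k + 1\<close>. In bases: \<open>C\<close> extends a basis \<open>B\<close> of
  the degree \<open>k\<close> part of \<open>I\<close>, and the products \<open>l * d\<close> with
  \<open>d\<close> in \<open>C - B\<close> stay independent of a basis \<open>E\<close> of
  \<open>I\<close> in the next degree.\<close>

lemma hilb_fun_le_Suc:
  assumes I: "idl.subspace I" and l: "l \<in> forms 1" "\<And>f. f \<in> forms k \<Longrightarrow> l * f \<in> I \<Longrightarrow> f \<in> I"
  shows "hilb_fun I k \<le> hilb_fun I (Suc k)"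
proof -
  obtain B where B: "B \<subseteq> I \<inter> forms k" "cvs.independent B" "I \<inter> forms k \<subseteq> cvs.span B"
      "card B = cvs.dim (I \<inter> forms k)"
    by (rule cvs.basis_exists)
  have "B \<subseteq> forms k" using B(1) by blast
  then obtain C where C: "B \<subseteq> C" "C \<subseteq> forms k" "cvs.independent C" "forms k \<subseteq> cvs.span C"
    using cvs.maximal_independent_subset_extend[OF _ B(2)] by blast
  obtain E where E: "E \<subseteq> I \<inter> forms (Suc k)" "cvs.independent E" "I \<inter> forms (Suc k) \<subseteq> cvs.span E"
      "card E = cvs.dim (I \<inter> forms (Suc k))"
    by (rule cvs.basis_exists)
  have fin: "finite C" "finite E" "finite B"
    using finite_independent_forms C(2,3) E(1,2) B(1,2) by blast+
  have cardC: "card C = cvs.dim (forms k)" by (rule cvs.basis_card_eq_dim[OF C(2,4,3)])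
  have "card (E <+> (C - B)) \<le> cvs.dim (forms (Suc k))"
  proof (rule card_le_dim_forms[where v = "case_sum (\<lambda>e. e) (\<lambda>d. l * d)"])
    fix x assume "x \<in> E <+> (C - B)"
    then show "case_sum (\<lambda>e. e) (\<lambda>d. l * d) x \<in> forms (Suc k)"
      using E(1) C(2) mult_in_forms[OF l(1)] by auto
  next
    fix c s
    assume "(\<Sum>x\<in>E <+> (C - B). smul (c x) (case_sum (\<lambda>e. e) (\<lambda>d. l * d) x)) = 0"
      and s: "s \<in> E <+> (C - B)"
    then have sum: "(\<Sum>e\<in>E. smul (c (Inl e)) e) + (\<Sum>d\<in>C - B. smul (c (Inr d)) (l * d)) = 0"
      using fin by (simp add: sum.Plus)
    define w where "w = (\<Sum>d\<in>C - B. smul (c (Inr d)) d)"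
    have lw: "(\<Sum>d\<in>C - B. smul (c (Inr d)) (l * d)) = l * w"
      by (simp add: w_def sum_distrib_left smul_mult_right)
    have "(\<Sum>e\<in>E. smul (c (Inl e)) e) \<in> I"
      by (rule idl.subspace_sum[OF I], rule ideal_smul[OF I]) (use E(1) in blast)
    then have "l * w \<in> I"
      using idl.subspace_neg[OF I, of "\<Sum>e\<in>E. smul (c (Inl e)) e"] sum lw
      by (simp add: add_eq_0_iff)
    moreover have wf: "w \<in> forms k"
      unfolding w_def
      by (rule cvs.subspace_sum[OF subspace_forms], rule smul_in_forms) (use C(2) in blast)
    \<comment> \<open>Regularity of \<open>l\<close> puts \<open>w\<close> into \<open>I\<close>; as
      \<open>w\<close> is also a combination of \<open>C - B\<close>, independence of
      \<open>C\<close> makes its coefficients vanish.\<close>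
    ultimately have "w \<in> cvs.span B" using l(2) B(3) by blast
    then obtain u where u: "w = (\<Sum>b\<in>B. smul (u b) b)"
      using cvs.span_finite[OF fin(3)] by auto
    have "(\<Sum>x\<in>C. smul (if x \<in> B then - u x else c (Inr x)) x)
        = (\<Sum>x\<in>C - B. smul (c (Inr x)) x) + (\<Sum>x\<in>B. smul (- u x) x)"
      by (subst sum.subset_diff[OF C(1) fin(1)]) (auto intro!: arg_cong2[of _ _ _ _ "(+)"] sum.cong)
    also have "\<dots> = 0" using u by (simp add: w_def sum_negf)
    finally have "(\<Sum>x\<in>C. smul (if x \<in> B then - u x else c (Inr x)) x) = 0" .
    note * = cvs.independentD[OF C(3) fin(1) subset_refl this]
    have c0: "c (Inr d) = 0" if "d \<in> C - B" for d
      using *[of d] that by auto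
    then have "(\<Sum>e\<in>E. smul (c (Inl e)) e) = 0" using sum by simp
    note ** = cvs.independentD[OF E(2) fin(2) subset_refl this]
    from s show "c s = 0" using c0 ** by auto
  qed (use fin in auto)
  then have "card E + (card C - card B) \<le> cvs.dim (forms (Suc k))"
    using fin C(1) by (simp add: card_Plus card_Diff_subset)
  then show ?thesis
    unfolding hilb_fun_def using B(4) E(4) cardC by linarith
qed

section \<open>Closed subschemes and their saturated ideals\<close>

lemma lookup_single_mult_add: "lookup (single a c * h) (a + m) = c * lookup h m"
  for h :: poly3
proof -
  have "single a c * h = (\<Sum>n\<in>keys h. single (a + n) (c * lookup h n))"
    by (subst sum_single_lookup[of h, symmetric]) (simp add: sum_distrib_left mult_single)
  then have "lookup (single a c * h) (a + m) = (\<Sum>n\<in>keys h. if n = m then c * lookup h n else 0)"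
    by (simp add: lookup_sum lookup_single when_def)
  then show ?thesis by (simp add: in_keys_iff)
qed

lemma lookup_single_mult_eq_0:
  fixes h :: poly3
  assumes "\<And>n. m \<noteq> a + n"
  shows "lookup (single a c * h) m = 0"
proof -
  have "m \<notin> keys (single a c * h)"
    using keys_mult[of "single a c" h] assms by (auto split: if_splits)
  then show ?thesis by (simp add: in_keys_iff)
qed

section \<open>Saturated ideals of closed subschemes\<close>

lemma chart_idealD:
  assumes "chart_ideal i I"
  shows "0 \<in> I" "f \<in> I \<Longrightarrow> g \<in> I \<Longrightarrow> f + g \<in> I" "f \<in> I \<Longrightarrow> dehom i h * f \<in> I" "I \<subseteq> chart i"
  using assms dehom_in_chart by (auto simp: chart_ideal_def)

lemma dehom_X_power_mult [simp]: "dehom i (X i ^ n * f) = dehom i f"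
  by (simp add: dehom_mult dehom_power)

lemma closed_subscheme_chart: "closed_subscheme Z \<Longrightarrow> chart_ideal i (Z i)"
  by (simp add: closed_subscheme_def)

lemma ideal_of_form_iff:
  assumes "closed_subscheme Z" "f \<in> forms k"
  shows "f \<in> ideal_of Z \<longleftrightarrow> (\<forall>i. dehom i f \<in> Z i)"
  using chart_idealD(1)[OF closed_subscheme_chart[OF assms(1)]]
  by (auto simp: ideal_of_def hom_part_form[OF assms(2)])

lemma subspace_ideal_of:
  assumes Z: "closed_subscheme Z"
  shows "idl.subspace (ideal_of Z)"
  unfolding idl.subspace_def
proof (intro conjI ballI allI)
  note Zi = chart_idealD[OF closed_subscheme_chart[OF Z]]
  show "0 \<in> ideal_of Z" by (simp add: ideal_of_def Zi(1))
  fix f assume f: "f \<in> ideal_of Z"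
  show "f + g \<in> ideal_of Z" if "g \<in> ideal_of Z" for g
    using f that by (simp add: ideal_of_def hom_part_add dehom_add Zi(2))
  show "g * f \<in> ideal_of Z" for g
    unfolding ideal_of_def
  proof (intro CollectI allI)
    fix k i
    have "dehom i (hom_part k (single m d * f)) \<in> Z i" for m d
      using f by (simp add: hom_part_single_mult dehom_mult Zi(1,3) ideal_of_def)
    then have *: "dehom i (hom_part k (\<Sum>m\<in>A. single m (lookup g m) * f)) \<in> Z i" for A
      by (induction A rule: infinite_finite_induct) (simp_all add: hom_part_add dehom_add Zi(1,2))
    have "g * f = (\<Sum>m\<in>keys g. single m (lookup g m) * f)"
      by (simp add: sum_single_lookup flip: sum_distrib_right)
    with * show "dehom i (hom_part k (g * f)) \<in> Z i" by simp
  qed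
qed

text \<open>On chart \<open>i\<close> the variable \<open>X i\<close> becomes 1, so multiplying by
  its powers does not change the local section.\<close>

lemma ideal_of_saturated:
  assumes "closed_subscheme Z" "f \<in> forms k" "\<And>i. \<exists>n. X i ^ n * f \<in> ideal_of Z"
  shows "f \<in> ideal_of Z"
  unfolding ideal_of_form_iff[OF assms(1,2)]
proof
  fix i
  obtain n where "X i ^ n * f \<in> ideal_of Z" using assms(3) by blast
  then have "dehom i (X i ^ n * f) \<in> Z i"
    using ideal_of_form_iff[OF assms(1) mult_in_forms[OF X_power_in_forms assms(2)]] by blast
  then show "dehom i f \<in> Z i" by simp
qed

lemma hilb_fun_ideal_of_mono:
  assumes Z: "closed_subscheme Z" and "k \<le> l"
  shows "hilb_fun (ideal_of Z) k \<le> hilb_fun (ideal_of Z) l"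
proof (rule lift_Suc_mono_le[OF _ assms(2)])
  fix j
  obtain h where "h \<in> forms 1" "\<forall>f\<in>forms j. h * f \<in> ideal_of Z \<longrightarrow> f \<in> ideal_of Z"
    using exists_regular_linear_form[OF subspace_ideal_of[OF Z], of j] ideal_of_saturated[OF Z] by blast
  then show "hilb_fun (ideal_of Z) j \<le> hilb_fun (ideal_of Z) (Suc j)"
    by (intro hilb_fun_le_Suc[OF subspace_ideal_of[OF Z], of h]) auto
qed

text \<open>Clearing denominators: a homogenized local section extends over the other charts after
  multiplication by a power of \<open>X i\<close>, which is invisible on chart
  \<open>i\<close>.\<close>

lemma closed_subscheme_lift:
  assumes Z: "closed_subscheme Z" and f: "f \<in> Z i"
  shows "\<exists>k. \<exists>g\<in>ideal_of Z \<inter> forms k. dehom i g = f"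
proof -
  have "f \<in> chart i" using chart_idealD(4)[OF closed_subscheme_chart[OF Z]] f by blast
  then obtain k g where g: "g \<in> forms k" "dehom i g = f" using dehom_surj by blast
  have "\<exists>n. dehom j (X i ^ n * g) \<in> Z j" for j
  proof -
    have "dehom i (X j ^ 0 * g) \<in> Z i" using f g(2) by simp
    then show ?thesis using Z g(1) unfolding closed_subscheme_def by blast
  qed
  then obtain n where n: "\<And>j. dehom j (X i ^ n j * g) \<in> Z j" by metis
  define N where "N = (\<Sum>j\<in>UNIV. n j)"
  have "dehom j (X i ^ N * g) \<in> Z j" for j
  proof -
    have "n j \<le> N" unfolding N_def by (rule member_le_sum) auto
    then have "X i ^ N * g = X i ^ (N - n j) * (X i ^ n j * g)"
      by (simp flip: power_add mult.assoc)
    then show ?thesis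
      using chart_idealD(3)[OF closed_subscheme_chart[OF Z] n] by (simp only: dehom_mult)
  qed
  moreover have "X i ^ N * g \<in> forms (N + k)" using g(1) by (intro mult_in_forms X_power_in_forms)
  ultimately have "X i ^ N * g \<in> ideal_of Z \<inter> forms (N + k)"
    using ideal_of_form_iff[OF Z] by blast
  then show ?thesis using g(2) by (metis dehom_X_power_mult)
qed

section \<open>Subschemes defined by ideals\<close>

lemma dehom_eq_shift:
  assumes "f \<in> forms k" "g \<in> forms l" "dehom i f = dehom i g"
  shows "X i ^ l * f = X i ^ k * g"
\<comment> \<open>\<open>dehom\<close> forgets degrees; the complementary powers of
  \<open>X i\<close> bring both forms to degree \<open>l + k\<close>, where it is injective.\<close>
proof (rule dehom_inj[where i = i])
  show "X i ^ l * f \<in> forms (l + k)" "X i ^ k * g \<in> forms (l + k)"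
    using mult_in_forms[OF X_power_in_forms assms(1), of i l]
      mult_in_forms[OF X_power_in_forms assms(2), of i k] by (simp_all add: add.commute)
qed (simp add: assms(3))

text \<open>Forms with the same chart section agree up to powers of \<open>X i\<close>; this is
  localization at \<open>X i\<close> written without fractions.\<close>

lemma Proj_quot_form_iff:
  assumes J: "idl.subspace J" and f: "f \<in> forms k"
  shows "dehom i f \<in> Proj_quot J i \<longleftrightarrow> (\<exists>n. X i ^ n * f \<in> J)"
proof
  assume "dehom i f \<in> Proj_quot J i"
  then obtain g l where g: "g \<in> J" "g \<in> forms l" "dehom i f = dehom i g"
    by (auto simp: Proj_quot_def)
  have "X i ^ l * f = X i ^ k * g" by (rule dehom_eq_shift[OF f g(2,3)])
  then show "\<exists>n. X i ^ n * f \<in> J" using ideal_mult[OF J g(1)] by metis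
next
  assume "\<exists>n. X i ^ n * f \<in> J"
  then obtain n where "X i ^ n * f \<in> J" by blast
  moreover have "X i ^ n * f \<in> forms (n + k)" using f by (intro mult_in_forms X_power_in_forms)
  moreover have "dehom i f = dehom i (X i ^ n * f)" by simp
  ultimately show "dehom i f \<in> Proj_quot J i" unfolding Proj_quot_def by blast
qed

lemma closed_subscheme_Proj_quot:
  assumes J: "idl.subspace J"
  shows "closed_subscheme (Proj_quot J)"
  unfolding closed_subscheme_def
proof (intro conjI allI ballI)
  fix i
  have "f + g \<in> Proj_quot J i" if fg: "f \<in> Proj_quot J i" "g \<in> Proj_quot J i" for f g
  proof -
    obtain f' k g' l where f': "f' \<in> J" "f' \<in> forms k" "f = dehom i f'"
      and g': "g' \<in> J" "g' \<in> forms l" "g = dehom i g'"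
      using fg by (auto simp: Proj_quot_def)
    have "X i ^ l * f' \<in> forms (l + k)" by (rule mult_in_forms[OF X_power_in_forms f'(2)])
    moreover have "X i ^ k * g' \<in> forms (l + k)"
      using mult_in_forms[OF X_power_in_forms g'(2), of i k] by (simp add: add.commute)
    ultimately have "X i ^ l * f' + X i ^ k * g' \<in> J \<inter> forms (l + k)"
      using f'(1) g'(1) by (simp add: add_in_forms idl.subspace_add[OF J] ideal_mult[OF J])
    moreover have "f + g = dehom i (X i ^ l * f' + X i ^ k * g')"
      by (simp add: dehom_add f'(3) g'(3))
    ultimately show ?thesis unfolding Proj_quot_def by blast
  qed
  moreover have "f * g \<in> Proj_quot J i" if f: "f \<in> chart i" and g: "g \<in> Proj_quot J i" for f g
  proof -
    obtain f' k where f': "f' \<in> forms k" "dehom i f' = f" using dehom_surj[OF f] by blast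
    obtain g' l where g': "g' \<in> J" "g' \<in> forms l" "g = dehom i g'"
      using g by (auto simp: Proj_quot_def)
    have "f' * g' \<in> J \<inter> forms (k + l)" using f'(1) g'(1,2) by (simp add: mult_in_forms ideal_mult[OF J])
    moreover have "f * g = dehom i (f' * g')" by (simp add: dehom_mult f'(2) g'(3))
    ultimately show ?thesis unfolding Proj_quot_def by blast
  qed
  moreover have "0 \<in> Proj_quot J i"
    using Proj_quot_form_iff[OF J zero_in_forms] idl.subspace_0[OF J] by simp
  moreover have "Proj_quot J i \<subseteq> chart i" by (auto simp: Proj_quot_def dehom_in_chart)
  ultimately show "chart_ideal i (Proj_quot J i)" by (auto simp: chart_ideal_def)
next
  fix i j k f assume f: "f \<in> forms k"
  \<comment> \<open>On the overlap both conditions say that some monomial in \<open>X i\<close> and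
    \<open>X j\<close> multiplies \<open>f\<close> into \<open>J\<close>, which is symmetric in
    \<open>i\<close> and \<open>j\<close>.\<close>
  have "(\<exists>n. dehom i (X j ^ n * f) \<in> Proj_quot J i) \<longleftrightarrow> (\<exists>n p. X i ^ p * (X j ^ n * f) \<in> J)" for i j
    using Proj_quot_form_iff[OF J mult_in_forms[OF X_power_in_forms f]] by blast
  then show "(\<exists>n. dehom i (X j ^ n * f) \<in> Proj_quot J i) \<longleftrightarrow> (\<exists>n. dehom j (X i ^ n * f) \<in> Proj_quot J j)"
    by (metis mult.left_commute)
qed

text \<open>Multiplication by \<open>X i ^ N\<close> moves a form into degrees at least
  \<open>N\<close> without changing its chart section.\<close>

lemma Proj_quot_mono:
  assumes I: "idl.subspace I" and sub: "\<And>k. N \<le> k \<Longrightarrow> I \<inter> forms k \<subseteq> J"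
  shows "Proj_quot I i \<subseteq> Proj_quot J i"
proof
  fix f assume "f \<in> Proj_quot I i"
  then obtain g k where g: "g \<in> I" "g \<in> forms k" "f = dehom i g" by (auto simp: Proj_quot_def)
  have "X i ^ N * g \<in> I \<inter> forms (N + k)"
    using g by (simp add: ideal_mult[OF I] mult_in_forms X_power_in_forms)
  then have "X i ^ N * g \<in> J \<inter> forms (N + k)" using sub[of "N + k"] by auto
  moreover have "f = dehom i (X i ^ N * g)" using g by simp
  ultimately show "f \<in> Proj_quot J i" unfolding Proj_quot_def by blast
qed

lemma Proj_quot_eqI:
  assumes "idl.subspace I" "idl.subspace J" "\<And>k. N \<le> k \<Longrightarrow> I \<inter> forms k = J \<inter> forms k"
  shows "Proj_quot I = Proj_quot J"
proof
  fix i show "Proj_quot I i = Proj_quot J i"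
    using Proj_quot_mono[OF assms(1), of N J i] Proj_quot_mono[OF assms(2), of N I i] assms(3) by blast
qed

lemma Proj_quot_ideal_of:
  assumes Z: "closed_subscheme Z"
  shows "Proj_quot (ideal_of Z) = Z"
proof
  fix i
  have "dehom i f \<in> Z i" if "f \<in> ideal_of Z" "f \<in> forms k" for f k
    using that ideal_of_form_iff[OF Z] by blast
  then show "Proj_quot (ideal_of Z) i = Z i"
    using closed_subscheme_lift[OF Z, of _ i] by (fastforce simp: Proj_quot_def)
qed

section \<open>The complete intersection\<close>

lemma keys_hom_part: "keys (hom_part k f) = {m \<in> keys f. mdeg m = k}"
  by (auto simp: in_keys_iff lookup_hom_part split: if_splits)

lemma ci_ideal_iff_hom_part: "f \<in> ci_ideal a b \<longleftrightarrow> (\<forall>k. hom_part k f \<in> ci_ideal a b)"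
  by (auto simp: ci_ideal_def keys_hom_part)

lemma ideal_of_Proj_quot_ci_ideal: "ideal_of (Proj_quot (ci_ideal a b)) = ci_ideal a b"
proof -
  \<comment> \<open>\<open>X 2\<close> is a nonzerodivisor modulo the complete intersection, since
    membership ignores the exponent of that variable; the chart of \<open>X 2\<close> thus already
    decides membership.\<close>
  have X2: "h \<in> ci_ideal a b" if h: "X 2 ^ n * h \<in> ci_ideal a b" for n h
    unfolding ci_ideal_def
  proof (intro CollectI ballI)
    fix m assume "m \<in> keys h"
    then have "single 2 n + m \<in> keys (X 2 ^ n * h)"
      unfolding X_power in_keys_iff lookup_single_mult_add by simp
    with h have "a < lookup (single 2 n + m) 0 \<or> b < lookup (single 2 n + m) 1"
      unfolding ci_ideal_def by blast
    then show "a < lookup m 0 \<or> b < lookup m 1"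
      by (simp add: lookup_add lookup_single when_def)
  qed
  have "(\<forall>i. dehom i (hom_part k f) \<in> Proj_quot (ci_ideal a b) i) \<longleftrightarrow> hom_part k f \<in> ci_ideal a b" for k f
    unfolding Proj_quot_form_iff[OF subspace_ci_ideal hom_part_in_forms]
  proof
    assume "\<forall>i. \<exists>n. X i ^ n * hom_part k f \<in> ci_ideal a b"
    then have "\<exists>n. X 2 ^ n * hom_part k f \<in> ci_ideal a b" by (rule spec)
    then show "hom_part k f \<in> ci_ideal a b" by (elim exE) (rule X2)
  qed (auto intro!: exI[of _ 0])
  then show ?thesis
    unfolding ideal_of_def by (intro Set.set_eqI) (simp only: mem_Collect_eq ci_ideal_iff_hom_part[symmetric])
qed

lemma monomial_factor_of_degree:
  assumes "n \<le> mdeg m"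
  shows "\<exists>u w. m = w + u \<and> mdeg u = n"
  using assms
proof (induction n)
  case 0
  show ?case by (intro exI[of _ 0] exI[of _ m]) (simp add: mdeg_def)
next
  case (Suc n)
  then obtain u w where uw: "m = w + u" "mdeg u = n" by auto
  with Suc.prems have "mdeg w \<noteq> 0" by (simp add: mdeg_add)
  then obtain i where i: "lookup w i \<noteq> 0" by (auto simp: mdeg_def)
  have "w - single i 1 + single i 1 = w"
    by (rule mono3_diff_add) (use i in \<open>auto simp: lookup_single when_def\<close>)
  then have "m = (w - single i 1) + (single i 1 + u)" using uw(1) by (simp flip: add.assoc)
  moreover have "mdeg (single i 1 + u) = Suc n" using uw(2) by (simp add: mdeg_add)
  ultimately show ?case by blast
qed

text \<open>Since \<open>a, b > 0\<close>, both generators of the complete intersection have degree at most \<open>a + b\<close>.\<close>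

lemma ci_ideal_forms_subset:
  assumes I: "idl.subspace I" and sub: "ci_ideal a b \<inter> forms (a + b) \<subseteq> I"
    and "0 < a" "0 < b" "a + b \<le> k"
  shows "ci_ideal a b \<inter> forms k \<subseteq> I"
proof clarify
  fix f assume f: "f \<in> ci_ideal a b" "f \<in> forms k"
  have "single m c \<in> I" if m: "m \<in> keys f" for m c
  proof -
    have factor: "single m c \<in> I"
      if e: "mdeg e \<le> a + b" "\<And>j. lookup e j \<le> lookup m j" "a < lookup e 0 \<or> b < lookup e 1" for e
    proof -
      have me: "m - e + e = m" by (rule mono3_diff_add[OF e(2)])
      then have "mdeg (m - e) = mdeg m - mdeg e" by (metis mdeg_add add_diff_cancel_right')
      moreover have "mdeg m = k" using f(2) m by (simp add: forms_def)
      \<comment> \<open>The generator \<open>e\<close> is enlarged by a divisor \<open>u\<close> of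
        the cofactor to degree exactly \<open>a + b\<close>, where \<open>sub\<close>
        applies.\<close>
      ultimately have "a + b - mdeg e \<le> mdeg (m - e)" using assms(5) by simp
      then obtain u w where uw: "m - e = w + u" "mdeg u = a + b - mdeg e"
        using monomial_factor_of_degree by blast
      have "single (u + e) 1 \<in> ci_ideal a b \<inter> forms (a + b)"
        using e(1,3) uw(2) by (auto simp: ci_ideal_def lookup_add mdeg_add intro: single_in_forms)
      with sub have "single (u + e) 1 \<in> I" by blast
      then have "single w c * single (u + e) 1 \<in> I" by (rule ideal_mult[OF I])
      moreover have "w + (u + e) = m" using uw(1) me by (simp add: add.assoc)
      ultimately show ?thesis by (simp add: mult_single)
    qed
    have "a < lookup m 0 \<or> b < lookup m 1" using f(1) m by (simp add: ci_ideal_def)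
    then show ?thesis
      using factor[of "single 0 (a + 1)"] factor[of "single 1 (b + 1)"] assms(3,4)
      by (auto simp: lookup_single when_def)
  qed
  then have "(\<Sum>m\<in>keys f. single m (lookup f m)) \<in> I" by (intro idl.subspace_sum[OF I])
  then show "f \<in> I" by (simp only: sum_single_lookup)
qed

text \<open>The Hilbert function enters as an upper bound in degree \<open>a + b\<close> and exactly
  in degree \<open>k\<close>: saturated ideals get the bound from monotonicity, ideals in
  \<open>Slip\<close> have both values prescribed.\<close>

lemma forms_eq_ci_ideal:
  assumes I: "idl.subspace I" and Ann: "I \<subseteq> Ann (single (expo a b c) 1)"
    and pos: "0 < a" "0 < b" and c: "a + b \<le> c"
    and hilb: "hilb_fun I (a + b) \<le> (a + 1) * (b + 1)" "hilb_fun I k = (a + 1) * (b + 1)"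
    and k: "a + b \<le> k"
  shows "I \<inter> forms k = ci_ideal a b \<inter> forms k"
proof -
  have "I \<inter> forms (a + b) \<subseteq> ci_ideal a b"
    using Ann Ann_forms_subset_ci_ideal[OF c, of a b] by blast
  then have "I \<inter> forms (a + b) = ci_ideal a b \<inter> forms (a + b)"
    using hilb(1) by (intro ideal_forms_eqI[OF I]) (simp_all add: hilb_fun_ci_ideal)
  then have "ci_ideal a b \<inter> forms (a + b) \<subseteq> I" by blast
  then have "ci_ideal a b \<inter> forms k \<subseteq> I" by (rule ci_ideal_forms_subset[OF I _ pos k])
  then show ?thesis
    using hilb(2) by (intro ideal_forms_eqI[OF subspace_ci_ideal, symmetric]) (simp_all add: hilb_fun_ci_ideal[OF k])
qed

lemma VPS_monomial:
  assumes pos: "0 < a" "0 < b" and c: "a + b \<le> c"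
  shows "VPS (single (expo a b c) 1) ((a + 1) * (b + 1)) = {Proj_quot (ci_ideal a b)}"
proof -
  have "Z = Proj_quot (ci_ideal a b)" if "Z \<in> VPS (single (expo a b c) 1) ((a + 1) * (b + 1))" for Z
  proof -
    obtain N where Z: "closed_subscheme Z" and Ann: "ideal_of Z \<subseteq> Ann (single (expo a b c) 1)"
      and N: "\<And>k. N \<le> k \<Longrightarrow> hilb_fun (ideal_of Z) k = (a + 1) * (b + 1)"
      using \<open>Z \<in> _\<close> by (auto simp: VPS_def Hilb_P2_def)
    \<comment> \<open>The degree \<open>N + (a + b)\<close> is beyond the threshold
      \<open>N\<close>, so monotonicity carries the eventual value down to degree
      \<open>a + b\<close> as an upper bound.\<close>
    have "hilb_fun (ideal_of Z) (a + b) \<le> hilb_fun (ideal_of Z) (N + (a + b))"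
      by (rule hilb_fun_ideal_of_mono[OF Z]) simp
    then have "hilb_fun (ideal_of Z) (a + b) \<le> (a + 1) * (b + 1)" using N by simp
    then have "Proj_quot (ideal_of Z) = Proj_quot (ci_ideal a b)"
      using N by (intro Proj_quot_eqI[where N = "N + (a + b)"] subspace_ideal_of[OF Z] subspace_ci_ideal
          forms_eq_ci_ideal[OF subspace_ideal_of[OF Z] Ann pos c]) auto
    then show ?thesis by (simp add: Proj_quot_ideal_of[OF Z])
  qed
  moreover have "Proj_quot (ci_ideal a b) \<in> VPS (single (expo a b c) 1) ((a + 1) * (b + 1))"
    using hilb_fun_ci_ideal[of a b]
    by (auto simp: VPS_def Hilb_P2_def ideal_of_Proj_quot_ci_ideal closed_subscheme_Proj_quot
        subspace_ci_ideal intro!: exI[of _ "a + b"] dest: subsetD[OF ci_ideal_subset_Ann])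
  ultimately show ?thesis by blast
qed

section \<open>The fiber condition on \<open>Slip\<close>\<close>

lemma Slip_subset_mHilb: "Slip r \<subseteq> mHilb (h_gen r)"
proof -
  \<comment> \<open>Every generating open set consists of points of \<open>mHilb\<close>, hence so
    does every closure in this space.\<close>
  have "topspace (zariski_mHilb (h_gen r)) \<subseteq> mHilb (h_gen r)"
    unfolding zariski_mHilb_def topology_generated_by_topspace by blast
  then show ?thesis
    unfolding Slip_def using closure_of_subset_topspace by (rule subset_trans[rotated])
qed

text \<open>Since \<open>VPS\<close> is a single point, it is enough to show for each
  \<open>J\<close> in \<open>Slip\<close> that apolarity to the monomial means defining that one
  scheme.\<close>

lemma fiber_type_monomial:
  assumes pos: "0 < a" "0 < b" and c: "a + b \<le> c"
  shows "fiber_type (single (expo a b c) 1) ((a + 1) * (b + 1))"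
proof -
  have "J \<subseteq> Ann (single (expo a b c) 1) \<longleftrightarrow> Proj_quot J = Proj_quot (ci_ideal a b)"
    if "J \<in> Slip ((a + 1) * (b + 1))" for J
  proof -
    from that have "J \<in> mHilb (h_gen ((a + 1) * (b + 1)))" using Slip_subset_mHilb by blast
    then have J: "idl.subspace J" and hom: "\<And>f k. f \<in> J \<Longrightarrow> hom_part k f \<in> J"
      and hilb: "\<And>k. a + b \<le> k \<Longrightarrow> hilb_fun J k = (a + 1) * (b + 1)"
      using h_gen_eq[of a b] by (simp_all add: mHilb_def homogeneous_ideal_def)
    show ?thesis
    proof
      assume "J \<subseteq> Ann (single (expo a b c) 1)"
      then show "Proj_quot J = Proj_quot (ci_ideal a b)"
        using hilb by (intro Proj_quot_eqI[where N = "a + b"] J subspace_ci_ideal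
            forms_eq_ci_ideal[OF J _ pos c]) auto
    next
      assume eq: "Proj_quot J = Proj_quot (ci_ideal a b)"
      have "J \<subseteq> ideal_of (Proj_quot J)"
      proof
        fix f assume f: "f \<in> J"
        have "dehom i (hom_part k f) \<in> Proj_quot J i" for k i
          using hom[OF f] hom_part_in_forms unfolding Proj_quot_def by blast
        then show "f \<in> ideal_of (Proj_quot J)" by (simp add: ideal_of_def)
      qed
      also have "\<dots> = ci_ideal a b" by (simp add: eq ideal_of_Proj_quot_ci_ideal)
      finally show "J \<subseteq> Ann (single (expo a b c) 1)" using ci_ideal_subset_Ann by blast
    qed
  qed
  then show ?thesis
    unfolding fiber_type_def bVSP_def VPS_monomial[OF assms] by blast
qed

section \<open>Powers of linear forms\<close>

text \<open>The multi-index factorial: multiplying coefficients by it passes to divided-power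
  coordinates, where multinomial coefficients of powers disappear.\<close>

definition mfact :: "mono3 \<Rightarrow> complex" where
  "mfact m = (\<Prod>i\<in>UNIV. fact (lookup m i))"

definition meval :: "(3 \<Rightarrow> complex) \<Rightarrow> mono3 \<Rightarrow> complex" where
  "meval l m = (\<Prod>i\<in>UNIV. l i ^ lookup m i)"

lemma mfact_nonzero [simp]: "mfact m \<noteq> 0"
  by (simp add: mfact_def)

lemma mfact_single_add: "mfact (single i 1 + n) = of_nat (Suc (lookup n i)) * mfact n"
proof -
  have "mfact (single i 1 + n)
      = (\<Prod>j\<in>UNIV. (if j = i then of_nat (Suc (lookup n i)) else 1) * fact (lookup n j))"
    unfolding mfact_def by (intro prod.cong refl) (auto simp: lookup_add lookup_single when_def)
  then show ?thesis by (simp add: prod.distrib mfact_def del: of_nat_Suc)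
qed

lemma meval_add: "meval l (m + n) = meval l m * meval l n"
  by (simp add: meval_def lookup_add power_add prod.distrib)

lemma meval_single: "meval l (single i k) = l i ^ k"
proof -
  have "meval l (single i k) = (\<Prod>j\<in>UNIV. if j = i then l i ^ k else 1)"
    unfolding meval_def by (intro prod.cong refl) (auto simp: lookup_single when_def)
  then show ?thesis by simp
qed

lemma mdeg_eq_0_iff: "mdeg m = 0 \<longleftrightarrow> m = 0"
  by (auto simp: mdeg_def poly_mapping_eq_iff fun_eq_iff)

lemma mdeg_eq_1D:
  assumes "mdeg m = 1"
  shows "\<exists>i. m = single i 1"
proof -
  obtain i where i: "lookup m i \<noteq> 0"
    using assms unfolding mdeg_def by (metis sum.neutral zero_neq_one)
  have m: "m - single i 1 + single i 1 = m"
    by (rule mono3_diff_add) (use i in \<open>auto simp: lookup_single when_def\<close>)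
  from arg_cong[OF this, of mdeg] assms have "m - single i 1 = 0"
    by (simp add: mdeg_add mdeg_eq_0_iff)
  with m show ?thesis by auto
qed

lemma single_Suc_0_eq_iff [simp]: "single i (Suc 0) = single j (Suc 0) \<longleftrightarrow> i = j"
  by (metis lookup_single_eq lookup_single_not_eq nat.distinct(1))

lemma linear_form_eq:
  assumes "L \<in> forms 1"
  shows "L = (\<Sum>i\<in>UNIV. single (single i 1) (lookup L (single i 1)))"
proof (rule poly_mapping_eqI)
  fix m
  have eq: "lookup (\<Sum>i\<in>UNIV. single (single i 1) (lookup L (single i 1))) m
      = (\<Sum>i\<in>UNIV. if single i 1 = m then lookup L m else 0)"
    unfolding lookup_sum by (intro sum.cong refl) (auto simp: lookup_single when_def)
  show "lookup L m = lookup (\<Sum>i\<in>UNIV. single (single i 1) (lookup L (single i 1))) m"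
  proof (cases "mdeg m = 1")
    case True
    then obtain j where "m = single j 1" using mdeg_eq_1D by blast
    then show ?thesis unfolding eq by simp
  next
    case False
    then have L0: "lookup L m = 0" using assms by (auto simp: forms_iff)
    show ?thesis unfolding eq L0 by simp
  qed
qed

text \<open>The multinomial theorem with denominators cleared, by splitting off one factor
  \<open>L\<close> and summing over its three terms.\<close>

lemma lookup_power_linear_form:
  assumes L: "L \<in> forms 1" and "mdeg m = d"
  shows "mfact m * lookup (L ^ d) m = fact d * meval (\<lambda>i. lookup L (single i 1)) m"
  using assms(2)
proof (induction d arbitrary: m)
  case 0
  then show ?case by (simp add: mdeg_eq_0_iff mfact_def meval_def)
next
  case (Suc d)
  define l where "l i = lookup L (single i 1)" for i
  have "mfact m * lookup (single (single i 1) (l i) * L ^ d) m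
      = of_nat (lookup m i) * (fact d * meval l m)" for i
  proof (cases "lookup m i = 0")
    case True
    then have "m \<noteq> single i 1 + n" for n by (auto simp: lookup_add)
    then show ?thesis using True by (simp add: lookup_single_mult_eq_0)
  next
    case False
    define n where "n = m - single i 1"
    have m: "m = single i 1 + n"
      unfolding n_def by (subst add.commute, rule sym, rule mono3_diff_add)
        (use False in \<open>auto simp: lookup_single when_def\<close>)
    then have "mdeg n = d" using Suc.prems by (simp add: mdeg_add)
    have "mfact m * lookup (single (single i 1) (l i) * L ^ d) m
        = of_nat (Suc (lookup n i)) * (l i * (mfact n * lookup (L ^ d) n))"
      unfolding m lookup_single_mult_add mfact_single_add by (simp only: ac_simps)
    also have "mfact n * lookup (L ^ d) n = fact d * meval l n"
      using Suc.IH[OF \<open>mdeg n = d\<close>] by (simp add: l_def[abs_def])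
    also have "of_nat (Suc (lookup n i)) * (l i * (fact d * meval l n))
        = of_nat (lookup m i) * (fact d * meval l m)"
      by (simp add: m meval_add meval_single lookup_add del: of_nat_Suc One_nat_def) (simp add: ac_simps)
    finally show ?thesis .
  qed
  then have "mfact m * lookup (\<Sum>i\<in>UNIV. single (single i 1) (l i) * L ^ d) m
      = (\<Sum>i\<in>UNIV. of_nat (lookup m i) * (fact d * meval l m))"
    by (simp add: lookup_sum sum_distrib_left)
  \<comment> \<open>The exponents of \<open>m\<close> add up to \<open>Suc d\<close>, the factor
    that turns \<open>fact d\<close> into \<open>fact (Suc d)\<close>.\<close>
  also have "\<dots> = of_nat (mdeg m) * (fact d * meval l m)"
    by (simp add: mdeg_def sum_distrib_right)
  also have "(\<Sum>i\<in>UNIV. single (single i 1) (l i) * L ^ d) = L * L ^ d"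
    using linear_form_eq[OF L] by (simp add: l_def flip: sum_distrib_right)
  finally show ?case using Suc.prems by (simp add: l_def[abs_def] ac_simps)
qed

section \<open>Evaluation of polynomials\<close>

lemma insertion_superset:
  assumes "finite A" "keys p \<subseteq> A"
  shows "insertion v p = (\<Sum>m\<in>A. lookup p m * (\<Prod>i\<in>keys m. v i ^ lookup m i))"
  unfolding insertion_def using assms
  by (intro sum.mono_neutral_left) (auto simp: in_keys_iff)

lemma monomial_value_superset:
  fixes v :: "'i \<Rightarrow> complex"
  assumes "finite A" "keys m \<subseteq> A"
  shows "(\<Prod>i\<in>keys m. v i ^ lookup m i) = (\<Prod>i\<in>A. v i ^ lookup m i)"
  using assms by (intro prod.mono_neutral_left) (auto simp: in_keys_iff)

lemma monomial_value_add:
  fixes v :: "'i \<Rightarrow> complex"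
  shows "(\<Prod>i\<in>keys (m + n). v i ^ lookup (m + n) i)
    = (\<Prod>i\<in>keys m. v i ^ lookup m i) * (\<Prod>i\<in>keys n. v i ^ lookup n i)"
proof -
  have *: "(\<Prod>i\<in>keys k. v i ^ lookup k i) = (\<Prod>i\<in>keys m \<union> keys n. v i ^ lookup k i)"
    if "k \<in> {m + n, m, n}" for k
    using that keys_add[of m n] by (intro monomial_value_superset) auto
  show ?thesis
    by (simp only: *[of "m + n"] *[of m] *[of n] insert_iff simp_thms)
       (simp only: lookup_add power_add prod.distrib)
qed

lemma insertion_single: "insertion v (single m c) = c * (\<Prod>i\<in>keys m. v i ^ lookup m i)"
  by (subst insertion_superset[of "{m}"]) auto

lemma insertion_add: "insertion v (p + q) = insertion v p + insertion v q"
proof -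
  have "keys (p + q) \<subseteq> keys p \<union> keys q" by (rule keys_add)
  then show ?thesis
    by (simp add: insertion_superset[of "keys p \<union> keys q"] lookup_add distrib_right sum.distrib)
qed

lemma insertion_zero: "insertion v 0 = 0"
  by (simp add: insertion_def)

lemma insertion_sum: "insertion v (\<Sum>x\<in>A. f x) = (\<Sum>x\<in>A. insertion v (f x))"
  by (induction A rule: infinite_finite_induct) (simp_all add: insertion_add insertion_zero)

lemma insertion_mult: "insertion v (p * q) = insertion v p * insertion v q"
proof -
  have "p * q = (\<Sum>m\<in>keys p. single m (lookup p m)) * (\<Sum>n\<in>keys q. single n (lookup q n))"
    by (simp only: sum_single_lookup)
  also have "\<dots> = (\<Sum>m\<in>keys p. \<Sum>n\<in>keys q. single (m + n) (lookup p m * lookup q n))"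
    by (simp only: sum_product mult_single)
  finally show ?thesis
    unfolding insertion_def[of v p] insertion_def[of v q] sum_product
    by (simp add: insertion_sum insertion_single monomial_value_add ac_simps)
qed

lemma insertion_one: "insertion v 1 = 1"
  using insertion_single[of v 0 1] by simp

lemma comm_ring_hom_insertion: "comm_ring_hom (insertion v)"
  by unfold_locales (simp_all add: insertion_zero insertion_one insertion_add insertion_mult)

lemma tendsto_insertion:
  assumes "\<And>i. ((\<lambda>t. w t i) \<longlongrightarrow> v i) net"
  shows "((\<lambda>t. insertion (w t) p) \<longlongrightarrow> insertion v p) net"
  unfolding insertion_def by (intro tendsto_intros assms)

section \<open>Secant varieties\<close>

text \<open>Polynomials are continuous in the coefficients, so coefficientwise limits stay in the
  Zariski closure.\<close>

lemma closure_of_zariski_formsI: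
  assumes F: "F \<in> forms d" and net: "net \<noteq> bot"
    and G: "\<forall>\<^sub>F t in net. G t \<in> S \<inter> forms d"
    and lim: "\<And>m. ((\<lambda>t. lookup (G t) m) \<longlongrightarrow> lookup F m) net"
  shows "F \<in> zariski_forms d closure_of S"
proof -
  let ?B = "{{G \<in> forms d. insertion (lookup G) p \<noteq> 0} | p. True}"
  have ev: "\<forall>\<^sub>F t in net. G t \<in> U" if "generate_topology_on ?B U" "F \<in> U" for U
    using that
  proof (induction rule: generate_topology_on.induct)
    case (Int U V)
    then show ?case by (auto elim: eventually_elim2)
  next
    case (UN K)
    then obtain U where "U \<in> K" "F \<in> U" "\<forall>\<^sub>F t in net. G t \<in> U" by blast
    then show ?case by (auto elim: eventually_mono)
  next
    case (Basis U)
    then obtain p where U: "U = {G \<in> forms d. insertion (lookup G) p \<noteq> 0}" by blast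
    with Basis have "insertion (lookup F) p \<noteq> 0" by simp
    then have "\<forall>\<^sub>F t in net. insertion (lookup (G t)) p \<noteq> 0"
      using tendsto_imp_eventually_ne[OF tendsto_insertion[of "\<lambda>t. lookup (G t)", OF lim]] by blast
    with G show ?case unfolding U by eventually_elim auto
  qed auto
  \<comment> \<open>The constant polynomial 1 makes all of \<open>forms d\<close> a basic open set,
    which puts \<open>F\<close> into the space.\<close>
  have "F \<in> {G \<in> forms d. insertion (lookup G) 1 \<noteq> 0}" using F by (simp add: insertion_one)
  then have "F \<in> topspace (zariski_forms d)"
    unfolding zariski_forms_def topology_generated_by_topspace by blast
  moreover have "\<exists>y\<in>S. y \<in> U" if "F \<in> U" "openin (zariski_forms d) U" for U
  proof -
    have "\<forall>\<^sub>F t in net. G t \<in> U"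
      using that ev[of U] by (simp add: zariski_forms_def openin_topology_generated_by_iff)
    with G have "\<forall>\<^sub>F t in net. G t \<in> S \<and> G t \<in> U" by eventually_elim auto
    then show ?thesis using eventually_happens'[OF net] by blast
  qed
  ultimately show ?thesis unfolding in_closure_of by blast
qed

lemma closure_of_zariski_formsD:
  assumes "F \<in> zariski_forms d closure_of S" and "\<And>G. G \<in> S \<Longrightarrow> G \<in> forms d \<Longrightarrow> insertion (lookup G) p = 0"
  shows "insertion (lookup F) p = 0"
proof (rule ccontr)
  assume F: "insertion (lookup F) p \<noteq> 0"
  let ?U = "{G \<in> forms d. insertion (lookup G) p \<noteq> 0}"
  have "openin (zariski_forms d) ?U"
    unfolding zariski_forms_def by (rule topology_generated_by_Basis) blast
  moreover have "F \<in> ?U"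
  proof -
    have "F \<in> topspace (zariski_forms d)" using assms(1) by (simp add: in_closure_of)
    then show ?thesis using F unfolding zariski_forms_def topology_generated_by_topspace by blast
  qed
  moreover have "\<forall>T. F \<in> T \<and> openin (zariski_forms d) T \<longrightarrow> (\<exists>G. G \<in> S \<and> G \<in> T)"
    using assms(1) by (simp add: in_closure_of)
  ultimately have "\<exists>G. G \<in> S \<and> G \<in> ?U" by meson
  then show False using assms(2) by auto
qed

section \<open>Lower bound for the border rank\<close>

lemma det_sum_rank_one:
  fixes u w :: "nat \<Rightarrow> nat \<Rightarrow> complex"
  assumes "m < n"
  shows "Determinant.det (Matrix.mat n n (\<lambda>(s, t). \<Sum>k<m. u k s * w k t)) = 0"
proof -
  \<comment> \<open>A sum of \<open>m\<close> rank-one matrices factors through dimension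
    \<open>m\<close>; padding both factors with zeros to size \<open>n\<close> leaves row
    \<open>m\<close> of \<open>C\<close> zero, as \<open>m < n\<close>.\<close>
  define B where "B = Matrix.mat n n (\<lambda>(s, k). if k < m then u k s else 0)"
  define C where "C = Matrix.mat n n (\<lambda>(k, t). if k < m then w k t else 0)"
  have BC: "B \<in> carrier_mat n n" "C \<in> carrier_mat n n" by (simp_all add: B_def C_def)
  have "Matrix.mat n n (\<lambda>(s, t). \<Sum>k<m. u k s * w k t) = B * C"
  proof (rule eq_matI)
    fix s t assume st: "s < dim_row (B * C)" "t < dim_col (B * C)"
    then have "s < n" "t < n" using BC by auto
    then have "(B * C) $$ (s, t) = (\<Sum>k\<in>{0..<n}. (if k < m then u k s else 0) * (if k < m then w k t else 0))"
      by (simp add: B_def C_def scalar_prod_def)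
    also have "\<dots> = (\<Sum>k<m. u k s * w k t)"
      using assms by (intro sum.mono_neutral_cong_right) auto
    finally show "Matrix.mat n n (\<lambda>(s, t). \<Sum>k<m. u k s * w k t) $$ (s, t) = (B * C) $$ (s, t)"
      using \<open>s < n\<close> \<open>t < n\<close> by simp
  qed (use BC in auto)
  moreover have "Determinant.det C = 0"
  proof -
    have "(\<Prod>i = 0..<n. C $$ (i, p i)) = 0" if "p permutes {0..<n}" for p
    proof (rule prod_zero)
      have "p m < n" using that assms permutes_in_image[OF that, of m] by simp
      then show "\<exists>i\<in>{0..<n}. C $$ (i, p i) = 0"
        using assms by (intro bexI[of _ m]) (auto simp: C_def)
    qed simp
    then show ?thesis
      unfolding det_def'[OF BC(2)] by (intro sum.neutral ballI) (simp only: mem_Collect_eq mult_zero_right)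
  qed
  ultimately show ?thesis using det_mult[OF BC] by simp
qed

text \<open>In the divided-power coordinates, scaled by \<open>mfact\<close>, a power of a linear form has a
  catalecticant matrix of rank one.\<close>

definition catalecticant_minor ::
    "nat \<Rightarrow> (nat \<Rightarrow> mono3) \<Rightarrow> (nat \<Rightarrow> mono3) \<Rightarrow> ((mono3 \<Rightarrow>\<^sub>0 nat) \<Rightarrow>\<^sub>0 complex)" where
  "catalecticant_minor n \<beta> \<gamma> = Determinant.det (Matrix.mat n n (\<lambda>(s, t).
     single (single (\<beta> s + \<gamma> t) 1) (mfact (\<beta> s + \<gamma> t))))"

lemma insertion_catalecticant_minor:
  "insertion v (catalecticant_minor n \<beta> \<gamma>)
     = Determinant.det (Matrix.mat n n (\<lambda>(s, t). mfact (\<beta> s + \<gamma> t) * v (\<beta> s + \<gamma> t)))"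
proof -
  interpret comm_ring_hom "insertion v" by (rule comm_ring_hom_insertion)
  show ?thesis
    unfolding catalecticant_minor_def hom_det[symmetric]
    by (rule arg_cong[of _ _ Determinant.det], rule eq_matI) (auto simp: insertion_single)
qed

text \<open>Each power contributes one rank-one matrix, because \<open>meval\<close> turns sums of
  exponents into products; fewer than \<open>n\<close> of them sum to a singular matrix.\<close>

lemma catalecticant_minor_vanishes:
  assumes deg: "\<And>s t. s < n \<Longrightarrow> t < n \<Longrightarrow> mdeg (\<beta> s + \<gamma> t) = d"
    and A: "A \<subseteq> veronese d" "finite A" "card A < n" and G: "G \<in> cvs.span A"
  shows "insertion (lookup G) (catalecticant_minor n \<beta> \<gamma>) = 0"
proof -
  obtain x where x: "bij_betw x {0..<card A} A" using ex_bij_betw_nat_finite[OF A(2)] by blast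
  obtain c where "G = (\<Sum>g\<in>A. smul (c g) g)" using G cvs.span_finite[OF A(2)] by auto
  then have G: "G = (\<Sum>k<card A. smul (c (x k)) (x k))"
    by (simp add: sum.reindex_bij_betw[OF x, symmetric] atLeast0LessThan)
  have "\<exists>L. L \<in> forms 1 \<and> x k = L ^ d" if "k < card A" for k
    using A(1) bij_betwE[OF x] that by (fastforce simp: veronese_def)
  then obtain L where L: "\<And>k. k < card A \<Longrightarrow> L k \<in> forms 1 \<and> x k = L k ^ d" by metis
  define l where "l k = meval (\<lambda>i. lookup (L k) (single i 1))" for k
  have "mfact (\<beta> s + \<gamma> t) * lookup G (\<beta> s + \<gamma> t)
      = (\<Sum>k<card A. (c (x k) * fact d * l k (\<beta> s)) * l k (\<gamma> t))" if st: "s < n" "t < n" for s t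
  proof -
    have "mfact (\<beta> s + \<gamma> t) * lookup G (\<beta> s + \<gamma> t)
        = (\<Sum>k<card A. c (x k) * (mfact (\<beta> s + \<gamma> t) * lookup (L k ^ d) (\<beta> s + \<gamma> t)))"
      unfolding G lookup_sum sum_distrib_left
      by (intro sum.cong refl) (use L in \<open>auto simp: ac_simps\<close>)
    also have "\<dots> = (\<Sum>k<card A. c (x k) * (fact d * l k (\<beta> s + \<gamma> t)))"
      using L by (intro sum.cong refl) (simp add: lookup_power_linear_form[OF _ deg[OF st]] l_def)
    finally show ?thesis by (simp add: l_def meval_add ac_simps)
  qed
  then have "Matrix.mat n n (\<lambda>(s, t). mfact (\<beta> s + \<gamma> t) * lookup G (\<beta> s + \<gamma> t))
      = Matrix.mat n n (\<lambda>(s, t). \<Sum>k<card A. (c (x k) * fact d * l k (\<beta> s)) * l k (\<gamma> t))"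
    by (intro eq_matI) auto
  then show ?thesis
    using det_sum_rank_one[OF A(3), of "\<lambda>k s. c (x k) * fact d * l k (\<beta> s)" "\<lambda>k t. l k (\<gamma> t)"]
    unfolding insertion_catalecticant_minor by simp
qed

lemma monomial_notin_secant:
  assumes c: "a + b \<le> c" and q: "q < (a + 1) * (b + 1)"
  shows "single (expo a b c) 1 \<notin> secant (a + b + c) q"
proof
  define n where "n = (a + 1) * (b + 1)"
  \<comment> \<open>Division by \<open>b + 1\<close> encodes the pairs of exponents up to
    \<open>a\<close> and \<open>b\<close> as \<open>s < n\<close>. The monomial
    \<open>\<beta> s\<close> has degree \<open>c\<close>, and \<open>\<gamma> s\<close> is its
    complement in \<open>expo a b c\<close>; \<open>a + b \<le> c\<close> keeps all exponents
    nonnegative.\<close>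
  define \<beta> where "\<beta> s = expo (s div (b + 1)) (s mod (b + 1)) (c - s div (b + 1) - s mod (b + 1))" for s
  define \<gamma> where "\<gamma> s = expo (a - s div (b + 1)) (b - s mod (b + 1)) (s div (b + 1) + s mod (b + 1))" for s
  have bd: "s div (b + 1) \<le> a" "s mod (b + 1) \<le> b" if "s < n" for s
    using that less_mult_imp_div_less[of s "a + 1" "b + 1"] by (simp_all add: n_def less_Suc_eq_le)
  have deg: "mdeg (\<beta> s + \<gamma> t) = a + b + c" if "s < n" "t < n" for s t
    using bd[OF that(1)] bd[OF that(2)] c unfolding \<beta>_def \<gamma>_def mdeg_add mdeg_expo by linarith
  have diag: "\<beta> s + \<gamma> t = expo a b c \<longleftrightarrow> s = t" if "s < n" "t < n" for s t
  proof
    assume eq: "\<beta> s + \<gamma> t = expo a b c"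
    have "s div (b + 1) + (a - t div (b + 1)) = a" "s mod (b + 1) + (b - t mod (b + 1)) = b"
      using arg_cong[OF eq, of "\<lambda>m. lookup m 0"] arg_cong[OF eq, of "\<lambda>m. lookup m 1"]
      unfolding \<beta>_def \<gamma>_def lookup_add lookup_expo by blast+
    then have "s div (b + 1) = t div (b + 1)" "s mod (b + 1) = t mod (b + 1)"
      using bd[OF that(1)] bd[OF that(2)] by linarith+
    then show "s = t" by (metis div_mult_mod_eq)
  next
    assume "s = t"
    show "\<beta> s + \<gamma> t = expo a b c"
      using bd[OF that(2)] c unfolding \<open>s = t\<close> \<beta>_def \<gamma>_def
      by (intro mono3_eqI; simp only: lookup_add lookup_expo; linarith)
  qed
  assume "single (expo a b c) 1 \<in> secant (a + b + c) q"
  then have "insertion (lookup (single (expo a b c) 1)) (catalecticant_minor n \<beta> \<gamma>) = 0"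
    unfolding secant_def
  proof (rule closure_of_zariski_formsD)
    fix G assume "G \<in> \<Union> {cvs.span A | A. A \<subseteq> veronese (a + b + c) \<and> finite A \<and> card A \<le> q}"
    then obtain A where "A \<subseteq> veronese (a + b + c)" "finite A" "card A < n" "G \<in> cvs.span A"
      using q by (auto simp: n_def)
    then show "insertion (lookup G) (catalecticant_minor n \<beta> \<gamma>) = 0"
      by (intro catalecticant_minor_vanishes[OF deg])
  qed
  \<comment> \<open>Exactly the diagonal entries meet the monomial itself, so the matrix is a scalar
    multiple of the identity.\<close>
  moreover have "insertion (lookup (single (expo a b c) 1)) (catalecticant_minor n \<beta> \<gamma>)
      = mfact (expo a b c) ^ n"
  proof -
    have "Matrix.mat n n (\<lambda>(s, t). mfact (\<beta> s + \<gamma> t) * lookup (single (expo a b c) 1) (\<beta> s + \<gamma> t))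
        = mfact (expo a b c) \<cdot>\<^sub>m 1\<^sub>m n"
      by (rule eq_matI) (auto simp: lookup_single when_def eq_commute[of "expo a b c"] diag diag[THEN iffD2])
    then show ?thesis unfolding insertion_catalecticant_minor by simp
  qed
  ultimately show False by simp
qed

section \<open>Upper bound for the border rank\<close>

lemma sum_root_of_unity_powers:
  fixes k a :: nat
  defines "\<zeta> \<equiv> cis (2 * pi / (a + 1))"
  shows "(\<Sum>i\<le>a. \<zeta> ^ (i * k)) = (if a + 1 dvd k then of_nat (a + 1) else 0)"
proof -
  have root: "\<zeta> ^ j = 1 \<longleftrightarrow> a + 1 dvd j" for j
  proof -
    have "\<zeta> ^ j = exp (2 * of_real pi * \<i> * of_nat j / of_nat (a + 1))"
      unfolding \<zeta>_def cis_conv_exp exp_of_nat_mult[symmetric]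
      by (rule arg_cong[of _ _ exp]) (simp add: field_simps)
    then show ?thesis using complex_root_unity_eq_1[of "a + 1" j] by simp
  qed
  \<comment> \<open>A geometric sum whose ratio \<open>\<zeta> ^ k\<close> is an
    \<open>(a + 1)\<close>-st root of unity.\<close>
  have "(\<Sum>i\<le>a. \<zeta> ^ (i * k)) = (\<Sum>i<a + 1. (\<zeta> ^ k) ^ i)"
    by (simp add: power_mult[symmetric] mult.commute lessThan_Suc_atMost)
  also have "\<dots> = (if a + 1 dvd k then of_nat (a + 1) else 0)"
  proof (cases "a + 1 dvd k")
    case False
    then have "\<zeta> ^ k \<noteq> 1" by (simp add: root)
    moreover have "(\<zeta> ^ k) ^ (a + 1) = 1"
      unfolding power_mult[symmetric] root by (rule dvd_triv_right)
    ultimately show ?thesis using False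
      by (simp only: geometric_sum if_False diff_self div_0 not_False_eq_True)
  next
    case True
    then have "\<zeta> ^ k = 1" by (simp only: root)
    with True show ?thesis by simp
  qed
  finally show ?thesis .
qed

text \<open>The weights \<open>\<zeta>\<^sup>i \<xi>\<^sup>j\<close> single out the exponents congruent to \<open>a\<close> modulo \<open>a + 1\<close> and to \<open>b\<close>
  modulo \<open>b + 1\<close>; among these the monomial has the lowest order in \<open>t\<close>.\<close>

lemma monomial_in_secant: "single (expo a b c) 1 \<in> secant (a + b + c) ((a + 1) * (b + 1))"
proof -
  define d where "d = a + b + c"
  define \<zeta> \<xi> where "\<zeta> = cis (2 * pi / (a + 1))" and "\<xi> = cis (2 * pi / (b + 1))"
  \<comment> \<open>\<open>K\<close> cancels the multinomial coefficient of the monomial and the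
    factors \<open>a + 1\<close> and \<open>b + 1\<close> from the two sums over roots of
    unity.\<close>
  define K where "K = mfact (expo a b c) / (fact d * of_nat (a + 1) * of_nat (b + 1))"
  define L where "L t i j = X 2 + smul (t * \<zeta> ^ i) (X 0) + smul (t * \<xi> ^ j) (X 1)" for t i j
  define G where "G t = (\<Sum>(i, j)\<in>{..a} \<times> {..b}. smul (K * (\<zeta> ^ i * \<xi> ^ j) / t ^ (a + b)) (L t i j ^ d))" for t
  have L: "L t i j \<in> forms 1" for t i j
    by (simp add: L_def add_in_forms smul_in_forms X_in_forms del: One_nat_def)
  have coeff: "lookup (L t i j) (single 0 1) = t * \<zeta> ^ i" "lookup (L t i j) (single 1 1) = t * \<xi> ^ j"
    "lookup (L t i j) (single 2 1) = 1" for t i j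
    by (simp_all add: L_def X_def lookup_add lookup_single when_def)
  have L_power: "L t i j ^ d \<in> forms d" for t i j using power_in_forms[OF L, where n = d] by simp
  have G_forms: "G t \<in> forms d" for t
    unfolding G_def by (rule cvs.subspace_sum[OF subspace_forms]) (auto intro: smul_in_forms L_power)
  \<comment> \<open>The coefficient of \<open>m\<close> in \<open>G t\<close> after dividing by
    \<open>t ^ (a + b)\<close>; as a polynomial in \<open>t\<close> it can be evaluated at
    \<open>t = 0\<close>.\<close>
  define H where "H m t = (if a + 1 dvd lookup m 0 + 1 \<and> b + 1 dvd lookup m 1 + 1 \<and> mdeg m = d
      then mfact (expo a b c) / mfact m * t ^ (lookup m 0 + lookup m 1 - (a + b)) else 0)" for m and t :: complex
  have G_eq: "lookup (G t) m = H m t" if t: "t \<noteq> 0" for t m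
  proof (cases "mdeg m = d")
    case False
    then show ?thesis using G_forms[of t] by (auto simp: forms_iff H_def)
  next
    case True
    \<comment> \<open>An exponent \<open>e\<close> with \<open>a + 1\<close> dividing
      \<open>e + 1\<close> is at least \<open>a\<close>; this keeps the power of \<open>t\<close> in
      \<open>H\<close> from being truncated.\<close>
    have le: "a \<le> lookup m 0" "b \<le> lookup m 1"
      if "a + 1 dvd lookup m 0 + 1" "b + 1 dvd lookup m 1 + 1"
      using that by (auto dest!: dvd_imp_le)
    have nz: "1 + complex_of_nat n \<noteq> 0" for n by (metis of_nat_Suc of_nat_neq_0)
    have "mfact m * lookup (G t) m
        = (\<Sum>(i, j)\<in>{..a} \<times> {..b}. K * (\<zeta> ^ i * \<xi> ^ j) / t ^ (a + b) * (mfact m * lookup (L t i j ^ d) m))"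
      unfolding G_def lookup_sum sum_distrib_left by (intro sum.cong refl) (auto simp: ac_simps)
    also have "\<dots> = (\<Sum>(i, j)\<in>{..a} \<times> {..b}. K * fact d * t ^ (lookup m 0 + lookup m 1) / t ^ (a + b)
        * (\<zeta> ^ (i * (lookup m 0 + 1)) * \<xi> ^ (j * (lookup m 1 + 1))))"
      unfolding lookup_power_linear_form[OF L True] meval_def prod_UNIV_three coeff
      by (intro sum.cong refl) (auto simp: power_add power_mult power_mult_distrib ac_simps)
    also have "\<dots> = K * fact d * t ^ (lookup m 0 + lookup m 1) / t ^ (a + b)
        * ((\<Sum>i\<le>a. \<zeta> ^ (i * (lookup m 0 + 1))) * (\<Sum>j\<le>b. \<xi> ^ (j * (lookup m 1 + 1))))"
      unfolding sum_product sum.cartesian_product by (simp only: sum_distrib_left case_prod_unfold)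
    also have "\<dots> = mfact m * H m t"
      unfolding sum_root_of_unity_powers[of a, folded \<zeta>_def] sum_root_of_unity_powers[of b, folded \<xi>_def]
      using True le t nz by (auto simp: H_def K_def power_diff)
    finally show ?thesis by simp
  qed
  have lim: "((\<lambda>t. lookup (G t) m) \<longlongrightarrow> lookup (single (expo a b c) 1) m) (at 0)" for m
  proof -
    \<comment> \<open>At \<open>t = 0\<close> only order zero survives: the first two exponents are
      exactly \<open>a\<close> and \<open>b\<close>, and the degree then makes the last one
      \<open>c\<close>.\<close>
    have H0: "H m 0 = lookup (single (expo a b c) 1) m"
    proof (cases "m = expo a b c")
      case False
      have "\<not> (a \<le> lookup m 0 \<and> b \<le> lookup m 1 \<and> mdeg m = d \<and> lookup m 0 + lookup m 1 \<le> a + b)"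
        using False by (auto simp: d_def mdeg_eq intro!: mono3_eqI)
      then show ?thesis using False by (auto simp: H_def lookup_single dest!: dvd_imp_le)
    qed (simp add: H_def d_def)
    have "(H m \<longlongrightarrow> H m 0) (at 0)"
    proof -
      have "continuous_on UNIV (H m)" unfolding H_def
        by (cases "a + 1 dvd lookup m 0 + 1 \<and> b + 1 dvd lookup m 1 + 1 \<and> mdeg m = d")
           (auto simp del: Suc_eq_plus1 intro!: continuous_intros)
      then show ?thesis by (simp add: continuous_on_def)
    qed
    moreover have "\<forall>\<^sub>F t in at 0. H m t = lookup (G t) m"
      by (auto simp: eventually_at_filter G_eq)
    ultimately show ?thesis unfolding H0 by (rule Lim_transform_eventually)
  qed
  have "single (expo a b c) 1 \<in> zariski_forms d closure_of
      (\<Union>{cvs.span A | A. A \<subseteq> veronese d \<and> finite A \<and> card A \<le> (a + 1) * (b + 1)})"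
  proof (rule closure_of_zariski_formsI[OF _ _ _ lim])
    show "single (expo a b c) 1 \<in> forms d" by (simp add: single_in_forms d_def)
    show "\<forall>\<^sub>F t in at 0. G t \<in> \<Union>{cvs.span A | A. A \<subseteq> veronese d \<and> finite A \<and> card A \<le> (a + 1) * (b + 1)} \<inter> forms d"
    proof (rule always_eventually, rule allI, rule IntI[OF UnionI G_forms])
      fix t
      let ?A = "(\<lambda>(i, j). L t i j ^ d) ` ({..a} \<times> {..b})"
      show "G t \<in> cvs.span ?A"
      proof -
        have "smul x (L t i j ^ d) \<in> cvs.span ?A" if "i \<le> a" "j \<le> b" for x i j
          using that by (intro cvs.span_scale cvs.span_base) auto
        then show ?thesis unfolding G_def by (intro cvs.span_sum) auto
      qed
      have "L t i j \<noteq> 0" for i j using coeff(3)[of t i j] by auto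
      then have "?A \<subseteq> veronese d" using L unfolding veronese_def by fast
      moreover have "card ?A \<le> (a + 1) * (b + 1)"
        using card_image_le[of "{..a} \<times> {..b}" "\<lambda>(i, j). L t i j ^ d"] by simp
      ultimately show "cvs.span ?A \<in> {cvs.span A | A. A \<subseteq> veronese d \<and> finite A \<and> card A \<le> (a + 1) * (b + 1)}"
        by blast
    qed
  qed simp
  then show ?thesis by (simp add: secant_def d_def)
qed

lemma border_rank_monomial:
  assumes "a + b \<le> c"
  shows "border_rank (single (expo a b c) 1) = (a + 1) * (b + 1)"
proof -
  have "total_degree (single (expo a b c) 1) = a + b + c" by (simp add: total_degree_def)
  then show ?thesis
    unfolding border_rank_def
    using monomial_in_secant monomial_notin_secant[OF assms]
    by (intro Least_equality) (auto simp: not_less[symmetric])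
qed

theorem proposition8p9:
  fixes a b c r :: nat and F :: poly3 and J :: "poly3 set"
  assumes "0 < a" and "a \<le> b" and "b \<le> c"
    and "F = X 0 ^ a * X 1 ^ b * X 2 ^ c"
    and "r = (a + 1) * (b + 1)"
    and "c \<ge> a + b"
    and "J = idl.span {X 0 ^ (a + 1), X 1 ^ (b + 1)}"
  shows "border_rank F = r \<and> VPS F r = {Proj_quot J} \<and> fiber_type F r"
proof (intro conjI)
  have b: "0 < b" using assms(1,2) by simp
  have F: "F = single (expo a b c) 1" by (simp only: assms(4) monomial_eq_single)
  show "border_rank F = r"
    unfolding F assms(5) by (rule border_rank_monomial[OF assms(6)])
  show "VPS F r = {Proj_quot J}"
    unfolding F assms(5,7) span_eq_ci_ideal by (rule VPS_monomial[OF assms(1) b assms(6)])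
  show "fiber_type F r"
    unfolding F assms(5) by (rule fiber_type_monomial[OF assms(1) b assms(6)])
qed

end
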